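(* Let $n\geq 5$ be an integer. Every topological tree $T$ with $n$ leaves satisfies $N(T)\geq n$, i.e. $T$ has at least $n$ nonisomorphic leaf-induced subtrees, with equality $N(T)=n$ if and only if $T$ is a star or a binary caterpillar (up to isomorphism of rooted trees).
   Context: A topological tree is a (finite) rooted tree with no vertex of outdegree $1$ (the one-vertex tree is a topological tree). Leaves are the vertices of outdegree $0$; the other vertices are internal vertices. Leaf-induced subtrees: let $T$ be a topological tree and $S$ a nonempty subset of its leaves. The subtree induced by $S$ is obtained as follows: (1) take the most recent common ancestor of the leaves in $S$ and all vertices and edges on the paths connecting it to the leaves in $S$, giving a tree rooted at that common ancestor; (2) contract every vertex of outdegree $1$ in this tree (if $g$ has outdegree $1$ and neighbours $f$ and $h$, delete $g$ and add the edge $\{f,h\}$). The result is again a topological tree; a single leaf induces the one-vertex tree. Isomorphism means isomorphism of rooted trees (root-preserving, children unordered). $N(T)$ denotes the number of isomorphism classes of leaf-induced subtrees of $T$, over all nonempty subsets $S$ of leaves. The star with $n$ leaves consists of a root with $n$ children, all of which are leaves. The binary caterpillar with $n$ leaves is the rooted tree in which every vertex has outdegree $0$ or $2$ and whose internal vertices form a path starting at the root: every internal vertex has exactly one leaf child and one internal child, except the deepest internal vertex, which has two leaf children. *)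

theory Defs
  imports Main
begin

text \<open>Rooted trees are oriented away from the root: an arc \<open>(u, v)\<close> says that \<open>u\<close> is
  the parent of \<open>v\<close>.\<close>

record 'a rtree =
  tverts :: "'a set"
  troot :: 'a
  tarcs :: "('a \<times> 'a) set"

definition rooted_tree :: "'a rtree \<Rightarrow> bool" where
  "rooted_tree T \<longleftrightarrow>
     finite (tverts T) \<and> troot T \<in> tverts T \<and> tarcs T \<subseteq> tverts T \<times> tverts T \<and>
     (\<forall>u. (u, troot T) \<notin> tarcs T) \<and>
     (\<forall>v\<in>tverts T - {troot T}. \<exists>!u. (u, v) \<in> tarcs T) \<and>
     (\<forall>v\<in>tverts T. (troot T, v) \<in> (tarcs T)\<^sup>*)"

definition children :: "'a rtree \<Rightarrow> 'a \<Rightarrow> 'a set" where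
  "children T v = {w. (v, w) \<in> tarcs T}"

definition outdegree :: "'a rtree \<Rightarrow> 'a \<Rightarrow> nat" where
  "outdegree T v = card (children T v)"

definition leaves :: "'a rtree \<Rightarrow> 'a set" where
  "leaves T = {v \<in> tverts T. outdegree T v = 0}"

definition internals :: "'a rtree \<Rightarrow> 'a set" where
  "internals T = tverts T - leaves T"

definition topological_tree :: "'a rtree \<Rightarrow> bool" where
  "topological_tree T \<longleftrightarrow> rooted_tree T \<and> (\<forall>v\<in>tverts T. outdegree T v \<noteq> 1)"

definition rtree_iso :: "'a rtree \<Rightarrow> 'b rtree \<Rightarrow> bool" where
  "rtree_iso A B \<longleftrightarrow> (\<exists>f. bij_betw f (tverts A) (tverts B) \<and> f (troot A) = troot B \<and>
     (\<forall>u\<in>tverts A. \<forall>v\<in>tverts A. (u, v) \<in> tarcs A \<longleftrightarrow> (f u, f v) \<in> tarcs B))"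

text \<open>Every vertex counts as an ancestor of itself, so that the most recent common ancestor
  of a single leaf is this leaf.\<close>

definition common_ancestors :: "'a rtree \<Rightarrow> 'a set \<Rightarrow> 'a set" where
  "common_ancestors T S = {a \<in> tverts T. \<forall>s\<in>S. (a, s) \<in> (tarcs T)\<^sup>*}"

definition mrca :: "'a rtree \<Rightarrow> 'a set \<Rightarrow> 'a" where
  "mrca T S =
     (THE m. m \<in> common_ancestors T S \<and> (\<forall>a\<in>common_ancestors T S. (a, m) \<in> (tarcs T)\<^sup>*))"

definition spanned_subtree :: "'a rtree \<Rightarrow> 'a set \<Rightarrow> 'a rtree" where
  "spanned_subtree T S =
     \<lparr>tverts = {v \<in> tverts T. (mrca T S, v) \<in> (tarcs T)\<^sup>* \<and> (\<exists>s\<in>S. (v, s) \<in> (tarcs T)\<^sup>*)},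
      troot = mrca T S,
      tarcs = {(u, v) \<in> tarcs T. (mrca T S, u) \<in> (tarcs T)\<^sup>* \<and> (\<exists>s\<in>S. (v, s) \<in> (tarcs T)\<^sup>*)}\<rparr>"

text \<open>One contraction of a vertex \<open>g\<close> of outdegree 1 with parent \<open>f\<close> and child \<open>h\<close>. The root of
  a spanned subtree never has outdegree 1, so every vertex to be contracted has a parent.\<close>

inductive contract_step :: "'a rtree \<Rightarrow> 'a rtree \<Rightarrow> bool" where
  "(f, g) \<in> tarcs A \<Longrightarrow> children A g = {h} \<Longrightarrow>
   contract_step A
     \<lparr>tverts = tverts A - {g},
      troot = troot A,
      tarcs = insert (f, h) (tarcs A - {(f, g), (g, h)})\<rparr>"

text \<open>The contractions are carried out one after the other, in any order, until no vertex of
  outdegree 1 is left.\<close>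

definition leaf_induced_subtree :: "'a rtree \<Rightarrow> 'a set \<Rightarrow> 'a rtree \<Rightarrow> bool" where
  "leaf_induced_subtree T S B \<longleftrightarrow>
     contract_step\<^sup>*\<^sup>* (spanned_subtree T S) B \<and> (\<forall>v\<in>tverts B. outdegree B v \<noteq> 1)"

definition leaf_induced_subtrees :: "'a rtree \<Rightarrow> 'a rtree set" where
  "leaf_induced_subtrees T = {B. \<exists>S. S \<noteq> {} \<and> S \<subseteq> leaves T \<and> leaf_induced_subtree T S B}"

definition num_leaf_induced_subtrees :: "'a rtree \<Rightarrow> nat" where
  "num_leaf_induced_subtrees T =
     card (leaf_induced_subtrees T //
       {(A, B). A \<in> leaf_induced_subtrees T \<and> B \<in> leaf_induced_subtrees T \<and> rtree_iso A B})"

definition star_tree :: "nat \<Rightarrow> 'a rtree \<Rightarrow> bool" where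
  "star_tree n T \<longleftrightarrow>
     rooted_tree T \<and> outdegree T (troot T) = n \<and> children T (troot T) \<subseteq> leaves T"

text \<open>The list \<open>vs\<close> enumerates the path formed by the internal vertices, from the root down
  to the deepest one; it is empty for the caterpillar with one leaf.\<close>

definition binary_caterpillar :: "nat \<Rightarrow> 'a rtree \<Rightarrow> bool" where
  "binary_caterpillar n T \<longleftrightarrow>
     rooted_tree T \<and> card (leaves T) = n \<and>
     (\<forall>v\<in>tverts T. outdegree T v = 0 \<or> outdegree T v = 2) \<and>
     (\<exists>vs. distinct vs \<and> set vs = internals T \<and> (vs \<noteq> [] \<longrightarrow> hd vs = troot T) \<and>
        (\<forall>i. Suc i < length vs \<longrightarrow>
           children T (vs ! i) \<inter> internals T = {vs ! Suc i} \<and>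
           card (children T (vs ! i) \<inter> leaves T) = 1) \<and>
        (vs \<noteq> [] \<longrightarrow> card (children T (last vs) \<inter> leaves T) = 2))"

end

theory Submission
  imports Defs
begin

text \<open>Every number of leaves from \<open>1\<close> to \<open>n\<close> occurs among the induced subtrees, which gives the
  bound; equality means that induced subtrees with equally many leaves are isomorphic. The internal
  vertices of an induced subtree are the most recent common ancestors of pairs of its leaves, so it
  inherits from a star that there is one internal vertex, and from a caterpillar that the internal
  vertices have outdegree 2 and form a chain; either property fixes the isomorphism class once the
  number of leaves is known. Conversely, suppose that equality holds and the tree is not a star.
  Then some three leaves induce a tree with two internal vertices, so no vertex has three children.
  As \<open>n \<ge> 5\<close>, one child of the root has three leaves below it, which together with a leaf below the
  other child induce a caterpillar. Hence no four leaves induce the balanced binary tree, and any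
  two internal vertices are comparable.\<close>

section \<open>Rooted trees\<close>

text \<open>An induced subtree is given only through some sequence of contractions, in any order.
  All later arguments use the order-independent data of \<open>leaf_induced_props\<close>: the
  leaves, the internal vertices and the ancestor relation, all read off in the original tree, and an
  upper bound on outdegrees. Stars and caterpillars are treated alike: the internal vertices of
  their induced subtrees form a chain of constant outdegree, namely the number of leaves for a star
  and 2 for a caterpillar. In such a tree arcs are determined by depths, so isomorphisms come from
  counting vertices level by level, without recursion on trees. In the converse direction two
  invariants detect nonisomorphic subtrees: the number of internal vertices, for three leaves, and
  whether they form a chain, for four. The constant 5 is the pigeonhole bound that puts three leaves
  below one of two children of the root. It is sharp: the balanced binary tree with four leaves has
  exactly four induced subtrees up to isomorphism, but is neither a star nor a caterpillar.\<close>

lemma rooted_treeD: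
  assumes "rooted_tree T"
  shows rooted_tree_finite: "finite (tverts T)"
    and rooted_tree_root: "troot T \<in> tverts T"
    and rooted_tree_arcs: "tarcs T \<subseteq> tverts T \<times> tverts T"
    and rooted_tree_root_no_parent: "(u, troot T) \<notin> tarcs T"
    and rooted_tree_ex_parent: "v \<in> tverts T \<Longrightarrow> v \<noteq> troot T \<Longrightarrow> \<exists>u. (u, v) \<in> tarcs T"
    and rooted_tree_root_reach: "v \<in> tverts T \<Longrightarrow> (troot T, v) \<in> (tarcs T)\<^sup>*"
  using assms unfolding rooted_tree_def by blast+

lemma parent_unique:
  assumes "rooted_tree T" "(u, v) \<in> tarcs T" "(w, v) \<in> tarcs T"
  shows "u = w"
  using assms unfolding rooted_tree_def by blast

lemma arc_verts:
  assumes "rooted_tree T" "(u, v) \<in> tarcs T"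
  shows "u \<in> tverts T" "v \<in> tverts T"
  using rooted_tree_arcs[OF assms(1)] assms(2) by auto

lemma reach_verts:
  assumes "rooted_tree T" "(u, v) \<in> (tarcs T)\<^sup>*"
  shows "u \<in> tverts T \<longleftrightarrow> v \<in> tverts T"
  using assms(2) by (induction rule: rtrancl_induct) (auto dest: arc_verts[OF assms(1)])

lemma finite_children: "rooted_tree T \<Longrightarrow> finite (children T v)"
  unfolding children_def
  by (rule finite_subset[OF _ rooted_tree_finite]) (auto dest: arc_verts)

text \<open>Induction from the root downwards: a cycle through a vertex must enter it from its only
  parent, hence passes through that parent, and the root has no parent at all.\<close>

lemma no_cycle:
  assumes T: "rooted_tree T" shows "(v, v) \<notin> (tarcs T)\<^sup>+"
proof
  assume cyc: "(v, v) \<in> (tarcs T)\<^sup>+"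
  then have "v \<in> tverts T"
    by (meson T arc_verts(1) tranclD)
  then have "(troot T, v) \<in> (tarcs T)\<^sup>*"
    by (rule rooted_tree_root_reach[OF T])
  then have "(v, v) \<notin> (tarcs T)\<^sup>+"
  proof (induction rule: rtrancl_induct)
    case base
    then show ?case
      by (metis T rooted_tree_root_no_parent tranclD2)
  next
    case (step u v)
    show ?case
    proof
      assume "(v, v) \<in> (tarcs T)\<^sup>+"
      then obtain p where "(v, p) \<in> (tarcs T)\<^sup>*" "(p, v) \<in> tarcs T"
        by (meson tranclD2)
      with step(2) parent_unique[OF T] have "(v, u) \<in> (tarcs T)\<^sup>*"
        by metis
      with step(2) have "(u, u) \<in> (tarcs T)\<^sup>+"
        by (rule rtrancl_into_trancl2)
      with step.IH show False ..
    qed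
  qed
  with cyc show False
    by blast
qed

lemma reach_antisym:
  assumes "rooted_tree T" "(u, v) \<in> (tarcs T)\<^sup>*" "(v, u) \<in> (tarcs T)\<^sup>*"
  shows "u = v"
  using assms by (metis no_cycle rtranclD rtrancl_trancl_trancl)

lemma arc_not_reach_back:
  assumes "rooted_tree T" "(u, v) \<in> tarcs T" shows "(v, u) \<notin> (tarcs T)\<^sup>*"
  using assms by (meson no_cycle rtrancl_into_trancl2)

definition comparable :: "'a rtree \<Rightarrow> 'a \<Rightarrow> 'a \<Rightarrow> bool" where
  "comparable T u v \<longleftrightarrow> (u, v) \<in> (tarcs T)\<^sup>* \<or> (v, u) \<in> (tarcs T)\<^sup>*"

text \<open>Parents are unique, so the walk upwards from \<open>x\<close> is deterministic and one
  of the two ancestors is met before the other.\<close>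

lemma ancestors_comparable:
  assumes "rooted_tree T" "(u, x) \<in> (tarcs T)\<^sup>*" "(v, x) \<in> (tarcs T)\<^sup>*"
  shows "comparable T u v"
proof -
  have "single_valued ((tarcs T)\<inverse>)"
    using parent_unique[OF assms(1)] by (auto simp: single_valued_def)
  then have "(u, v) \<in> ((tarcs T)\<inverse>)\<^sup>* \<or> (v, u) \<in> ((tarcs T)\<inverse>)\<^sup>*"
    using assms(2,3) by (intro single_valued_confluent) (auto simp: rtrancl_converse)
  then show ?thesis
    by (auto simp: comparable_def rtrancl_converse)
qed

lemma reach_parent:
  assumes "rooted_tree T" "(u, v) \<in> (tarcs T)\<^sup>*" "u \<noteq> v" "(p, v) \<in> tarcs T"
  shows "(u, p) \<in> (tarcs T)\<^sup>*"
  using assms by (metis parent_unique rtranclE)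

text \<open>Subtrees below distinct siblings are disjoint: a common descendant would make the
  siblings comparable, and the upper one would then reach their parent.\<close>

lemma child_unique:
  assumes T: "rooted_tree T" and "(u, x) \<in> tarcs T" "(u, y) \<in> tarcs T"
    and "(x, a) \<in> (tarcs T)\<^sup>*" "(y, a) \<in> (tarcs T)\<^sup>*"
  shows "x = y"
proof (rule ccontr)
  assume "x \<noteq> y"
  moreover have "comparable T x y"
    using ancestors_comparable[OF T] assms by blast
  ultimately show False
    using assms(2,3) reach_parent[OF T] arc_not_reach_back[OF T] unfolding comparable_def by metis
qed

lemma internals_iff:
  assumes "rooted_tree T"
  shows "u \<in> internals T \<longleftrightarrow> (\<exists>v. (u, v) \<in> tarcs T)"
  using finite_children[OF assms, of u] arc_verts(1)[OF assms]
  by (auto simp: internals_def leaves_def outdegree_def children_def)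

lemma leaves_iff:
  assumes "rooted_tree T"
  shows "u \<in> leaves T \<longleftrightarrow> u \<in> tverts T \<and> (\<forall>v. (u, v) \<notin> tarcs T)"
  using finite_children[OF assms, of u]
  by (auto simp: leaves_def outdegree_def children_def)

lemma leaves_Un_internals: "leaves T \<union> internals T = tverts T" "leaves T \<inter> internals T = {}"
  by (auto simp: leaves_def internals_def)

lemma internals_subset: "internals T \<subseteq> tverts T"
  by (auto simp: internals_def)

lemma finite_internals: "rooted_tree T \<Longrightarrow> finite (internals T)"
  by (simp add: internals_def rooted_tree_finite)

lemma finite_leaves: "rooted_tree T \<Longrightarrow> finite (leaves T)"
  by (simp add: leaves_def rooted_tree_finite)

lemma card_verts: "rooted_tree T \<Longrightarrow> card (tverts T) = card (leaves T) + card (internals T)"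
  by (metis card_Un_disjoint finite_internals finite_leaves leaves_Un_internals)

lemma leaf_reach:
  assumes "rooted_tree T" "s \<in> leaves T" "(s, v) \<in> (tarcs T)\<^sup>*"
  shows "v = s"
  using assms by (metis converse_rtranclE leaves_iff)

text \<open>Every vertex but the root is a child of exactly one internal vertex. Combined with
  \<open>card_verts\<close>, this ties the number of leaves to the number of internal
  vertices.\<close>

lemma card_verts_eq_sum_outdegree:
  assumes T: "rooted_tree T"
  shows "card (tverts T) = Suc (\<Sum>v\<in>internals T. outdegree T v)"
proof -
  have "v \<in> tverts T - {troot T} \<longleftrightarrow> (\<exists>u. u \<in> internals T \<and> (u, v) \<in> tarcs T)" for v
    unfolding internals_iff[OF T]
    using rooted_tree_ex_parent[OF T, of v] arc_verts(2)[OF T, of _ v]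
      rooted_tree_root_no_parent[OF T] by blast
  then have "tverts T - {troot T} = (\<Union>v\<in>internals T. children T v)"
    by (auto simp: children_def)
  moreover have "card (\<Union>v\<in>internals T. children T v) = (\<Sum>v\<in>internals T. outdegree T v)"
    unfolding outdegree_def
    using finite_internals[OF T] finite_children[OF T] parent_unique[OF T]
    by (intro card_UN_disjoint) (auto simp: children_def)
  ultimately show ?thesis
    using rooted_tree_root[OF T] rooted_tree_finite[OF T] by (metis card.remove)
qed

section \<open>Depth, counted by proper ancestors, and choices of deepest vertices\<close>

definition depth :: "'a rtree \<Rightarrow> 'a \<Rightarrow> nat" where
  "depth T v = card {u. (u, v) \<in> (tarcs T)\<^sup>+}"

lemma finite_ancestors: "rooted_tree T \<Longrightarrow> finite {u. (u, v) \<in> (tarcs T)\<^sup>+}"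
  by (rule finite_subset[OF _ rooted_tree_finite]) (auto dest: tranclD arc_verts)

lemma depth_arc:
  assumes T: "rooted_tree T" and uv: "(u, v) \<in> tarcs T"
  shows "depth T v = Suc (depth T u)"
proof -
  have "{w. (w, v) \<in> (tarcs T)\<^sup>+} = insert u {w. (w, u) \<in> (tarcs T)\<^sup>+}"
    using uv parent_unique[OF T _ uv] by (blast elim: tranclE intro: trancl_into_trancl)
  then show ?thesis
    using no_cycle[OF T] finite_ancestors[OF T] by (simp add: depth_def)
qed

lemma depth_reach:
  assumes "rooted_tree T" "(u, v) \<in> (tarcs T)\<^sup>*"
  shows "u = v \<or> depth T u < depth T v"
  using assms(2) by (induction rule: rtrancl_induct) (auto dest: depth_arc[OF assms(1)])

lemma depth_eq_0_iff:
  assumes "rooted_tree T" "v \<in> tverts T"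
  shows "depth T v = 0 \<longleftrightarrow> v = troot T"
  using assms depth_reach[OF assms(1) rooted_tree_root_reach[OF assms]] finite_ancestors[OF assms(1)]
  by (auto simp: depth_def dest: tranclD2 rooted_tree_root_no_parent)

lemma ex_max_depth:
  assumes "finite D" "v \<in> D"
  shows "\<exists>s\<in>D. \<forall>w\<in>D. depth T w \<le> depth T s"
proof -
  have "Max (depth T ` D) \<in> depth T ` D"
    using assms by (intro Max_in) auto
  then obtain s where "s \<in> D" "depth T s = Max (depth T ` D)"
    by auto
  then show ?thesis
    using assms(1) by (auto intro!: bexI[of _ s])
qed

text \<open>A deepest descendant of \<open>v\<close> cannot have a child, since the child would be a
  deeper descendant.\<close>

lemma ex_leaf_below:
  assumes T: "rooted_tree T" and "v \<in> tverts T"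
  shows "\<exists>s\<in>leaves T. (v, s) \<in> (tarcs T)\<^sup>*"
proof -
  let ?D = "{w. (v, w) \<in> (tarcs T)\<^sup>*}"
  have fin: "finite ?D"
    using reach_verts[OF T] assms(2) by (intro finite_subset[OF _ rooted_tree_finite[OF T]]) auto
  have "v \<in> ?D"
    by simp
  then obtain s where s: "s \<in> ?D" "\<And>w. w \<in> ?D \<Longrightarrow> depth T w \<le> depth T s"
    using ex_max_depth[OF fin] by blast
  have "(s, w) \<notin> tarcs T" for w
    using s(2)[of w] s(1) depth_arc[OF T, of s w] by (auto dest: rtrancl_into_rtrancl)
  then show ?thesis
    using s(1) reach_verts[OF T] assms(2) by (auto simp: leaves_iff[OF T])
qed

text \<open>For distinct leaves \<open>a\<close> and \<open>b\<close>, this says that \<open>u\<close> is their most recent common ancestor.\<close>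

definition separates :: "'a rtree \<Rightarrow> 'a \<Rightarrow> 'a \<Rightarrow> 'a \<Rightarrow> bool" where
  "separates T u a b \<longleftrightarrow> (\<exists>x y. x \<noteq> y \<and> (u, x) \<in> tarcs T \<and> (u, y) \<in> tarcs T \<and>
     (x, a) \<in> (tarcs T)\<^sup>* \<and> (y, b) \<in> (tarcs T)\<^sup>*)"

lemma separates_reach:
  assumes "separates T u a b"
  shows "(u, a) \<in> (tarcs T)\<^sup>*" "(u, b) \<in> (tarcs T)\<^sup>*"
  using assms unfolding separates_def by (blast intro: converse_rtrancl_into_rtrancl)+

lemma separates_sym: "separates T u a b \<Longrightarrow> separates T u b a"
  unfolding separates_def by metis

lemma separates_neq: "rooted_tree T \<Longrightarrow> separates T u a b \<Longrightarrow> a \<noteq> b"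
  unfolding separates_def by (metis child_unique)

text \<open>Otherwise \<open>w\<close> lies strictly below \<open>u\<close>, and the child of
  \<open>u\<close> on the way to \<open>w\<close> is above both \<open>a\<close> and
  \<open>b\<close>, so it would have to equal both of the distinct children that separate
  them.\<close>

lemma separates_below:
  assumes T: "rooted_tree T" and sep: "separates T u a b"
    and "(w, a) \<in> (tarcs T)\<^sup>*" "(w, b) \<in> (tarcs T)\<^sup>*"
  shows "(w, u) \<in> (tarcs T)\<^sup>*"
proof (rule ccontr)
  assume "(w, u) \<notin> (tarcs T)\<^sup>*"
  moreover have "comparable T u w"
    using ancestors_comparable[OF T separates_reach(1)[OF sep] assms(3)] .
  ultimately have "(u, w) \<in> (tarcs T)\<^sup>*" "u \<noteq> w"
    by (auto simp: comparable_def)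
  then obtain z where z: "(u, z) \<in> tarcs T" "(z, w) \<in> (tarcs T)\<^sup>*"
    by (meson converse_rtranclE)
  then have "(z, a) \<in> (tarcs T)\<^sup>*" "(z, b) \<in> (tarcs T)\<^sup>*"
    using assms(3,4) by auto
  then show False
    using sep z(1) child_unique[OF T] unfolding separates_def by metis
qed

lemma separates_unique:
  assumes "rooted_tree T" "separates T u a b" "separates T v a b"
  shows "u = v"
  using assms by (meson reach_antisym separates_below separates_reach)

section \<open>Branching in topological trees\<close>

lemma topological_treeD: "topological_tree T \<Longrightarrow> rooted_tree T"
  by (simp add: topological_tree_def)

lemma outdegree_ge_2:
  assumes "topological_tree T" "u \<in> internals T"
  shows "outdegree T u \<ge> 2"
proof -
  have "outdegree T u \<noteq> 0" "outdegree T u \<noteq> 1"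
    using assms by (auto simp: topological_tree_def internals_def leaves_def)
  then show ?thesis
    by linarith
qed

lemma ex_other_child:
  assumes T: "topological_tree T" and "(u, x) \<in> tarcs T"
  shows "\<exists>y. (u, y) \<in> tarcs T \<and> y \<noteq> x"
proof (rule ccontr)
  assume "\<not> ?thesis"
  then have "children T u = {x}"
    using assms(2) unfolding children_def by blast
  moreover have "u \<in> internals T"
    using assms(2) internals_iff[OF topological_treeD[OF T]] by blast
  ultimately show False
    using outdegree_ge_2[OF T, of u] by (simp add: outdegree_def)
qed

lemma internal_separates:
  assumes T: "topological_tree T" and "u \<in> internals T"
  shows "\<exists>a\<in>leaves T. \<exists>b\<in>leaves T. separates T u a b"
proof -
  note R = topological_treeD[OF T]
  obtain x where x: "(u, x) \<in> tarcs T"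
    using assms internals_iff[OF R] by blast
  obtain y where y: "(u, y) \<in> tarcs T" "y \<noteq> x"
    using ex_other_child[OF T x] by blast
  show ?thesis
    using ex_leaf_below[OF R arc_verts(2)[OF R x]] ex_leaf_below[OF R arc_verts(2)[OF R y(1)]]
      x y unfolding separates_def by metis
qed

section \<open>Contraction\<close>

text \<open>Collects what one contraction preserves. The removed vertex has outdegree 1 and all
  other outdegrees stay the same, which later determines the surviving vertices independently of the
  order of contractions.\<close>

lemma contract_step_props:
  assumes "contract_step A B" and A: "rooted_tree A"
  shows "rooted_tree B" and "troot B = troot A" and "tverts B \<subset> tverts A"
    and "v \<in> tverts B \<Longrightarrow> outdegree B v = outdegree A v"
    and "v \<in> tverts A - tverts B \<Longrightarrow> outdegree A v = 1"
    and "u \<in> tverts B \<Longrightarrow> v \<in> tverts B \<Longrightarrow> (u, v) \<in> (tarcs B)\<^sup>* \<longleftrightarrow> (u, v) \<in> (tarcs A)\<^sup>*"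
proof -
  obtain f g h where fg: "(f, g) \<in> tarcs A" and ch: "children A g = {h}"
    and B: "B = \<lparr>tverts = tverts A - {g}, troot = troot A,
      tarcs = insert (f, h) (tarcs A - {(f, g), (g, h)})\<rparr>"
    using assms(1) by cases auto
  have gh: "(g, h) \<in> tarcs A" and gh': "\<And>w. (g, w) \<in> tarcs A \<Longrightarrow> w = h"
    using ch by (auto simp: children_def)
  have fg': "\<And>w. (w, g) \<in> tarcs A \<Longrightarrow> w = f" and hg': "\<And>w. (w, h) \<in> tarcs A \<Longrightarrow> w = g"
    using parent_unique[OF A] fg gh by blast+
  have neq: "f \<noteq> g" "h \<noteq> g" "g \<noteq> troot A" "h \<noteq> troot A"
    using no_cycle[OF A] rooted_tree_root_no_parent[OF A] fg gh by auto
  have vs: "f \<in> tverts A" "g \<in> tverts A" "h \<in> tverts A"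
    using arc_verts[OF A] fg gh by auto
  \<comment> \<open>The two deleted arcs are the only ones that touch \<open>g\<close>.\<close>
  have arcsB: "(x, y) \<in> tarcs B \<longleftrightarrow> x = f \<and> y = h \<or> (x, y) \<in> tarcs A \<and> x \<noteq> g \<and> y \<noteq> g" for x y
    using fg' gh' by (auto simp: B)
  have sub: "(tarcs B)\<^sup>* \<subseteq> (tarcs A)\<^sup>*"
  proof (rule rtrancl_subset_rtrancl, rule subsetI, clarify)
    fix x y assume "(x, y) \<in> tarcs B"
    then show "(x, y) \<in> (tarcs A)\<^sup>*"
      unfolding arcsB using fg gh by (auto intro: rtrancl_trans)
  qed
  \<comment> \<open>Strengthened for the induction: a path that currently ends at the deleted vertex
    is represented in \<open>B\<close> by its last stop \<open>f\<close>, from where the new arc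
    leads on to \<open>h\<close>.\<close>
  have sup: "(y \<noteq> g \<longrightarrow> (x, y) \<in> (tarcs B)\<^sup>*) \<and> (y = g \<longrightarrow> (x, f) \<in> (tarcs B)\<^sup>*)"
    if "(x, y) \<in> (tarcs A)\<^sup>*" "x \<noteq> g" for x y
    using that
  proof (induction rule: rtrancl_induct)
    case (step y z)
    consider "z = g" | "y = g" | "y \<noteq> g" "z \<noteq> g"
      by blast
    then show ?case
    proof cases
      case 1
      then show ?thesis
        using step fg' neq(1) by auto
    next
      case 2
      then have "(x, f) \<in> (tarcs B)\<^sup>*" "z = h"
        using step gh' by auto
      moreover have "(f, h) \<in> tarcs B"
        by (simp add: arcsB)
      ultimately show ?thesis
        using neq(2) by (auto intro: rtrancl_into_rtrancl)
    next
      case 3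
      then have "(y, z) \<in> tarcs B"
        using step arcsB by blast
      then show ?thesis
        using 3 step by (auto intro: rtrancl_into_rtrancl)
    qed
  qed auto
  show reach: "(u, v) \<in> (tarcs B)\<^sup>* \<longleftrightarrow> (u, v) \<in> (tarcs A)\<^sup>*" if "u \<in> tverts B" "v \<in> tverts B" for u v
    using that sub sup by (auto simp: B)
  show "troot B = troot A"
    by (simp add: B)
  show "tverts B \<subset> tverts A"
    using vs by (auto simp: B)
  show "outdegree A v = 1" if "v \<in> tverts A - tverts B"
    using that ch by (auto simp: B outdegree_def)
  show "outdegree B v = outdegree A v" if "v \<in> tverts B"
  proof (cases "v = f")
    case True
    have "children B f = insert h (children A f - {g})"
      using neq by (auto simp: children_def arcsB)
    moreover have "h \<notin> children A f" "g \<in> children A f"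
      using hg' neq fg by (auto simp: children_def)
    moreover from this have "card (children A f) > 0"
      using finite_children[OF A, of f] card_gt_0_iff by blast
    ultimately show ?thesis
      using True finite_children[OF A, of f] by (simp add: outdegree_def)
  next
    case False
    then have "children B v = children A v"
      using that fg' by (auto simp: children_def arcsB B)
    then show ?thesis
      by (simp add: outdegree_def)
  qed
  show "rooted_tree B"
    unfolding rooted_tree_def
  proof (intro conjI ballI allI)
    show "finite (tverts B)" "troot B \<in> tverts B"
      using rooted_tree_finite[OF A] rooted_tree_root[OF A] neq by (auto simp: B)
    show "tarcs B \<subseteq> tverts B \<times> tverts B"
    proof clarify
      fix x y assume "(x, y) \<in> tarcs B"
      then show "x \<in> tverts B \<and> y \<in> tverts B"
        using arc_verts[OF A, of x y] vs neq unfolding arcsB by (auto simp: B)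
    qed
    show "(u, troot B) \<notin> tarcs B" for u
    proof -
      have "troot B = troot A"
        by (simp add: B)
      then show ?thesis
        using rooted_tree_root_no_parent[OF A] neq unfolding arcsB by simp
    qed
    show "(troot B, v) \<in> (tarcs B)\<^sup>*" if "v \<in> tverts B" for v
    proof -
      have "troot B = troot A" "troot A \<in> tverts B" "v \<in> tverts A"
        using that rooted_tree_root[OF A] neq by (auto simp: B)
      then show ?thesis
        using reach[OF _ that] rooted_tree_root_reach[OF A] by simp
    qed
    show "\<exists>!u. (u, v) \<in> tarcs B" if "v \<in> tverts B - {troot B}" for v
    proof (cases "v = h")
      case True
      then show ?thesis
        unfolding arcsB using hg' by blast
    next
      case False
      have "v \<in> tverts A" "v \<noteq> troot A" "v \<noteq> g"
        using that by (auto simp: B)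
      then obtain u where "(u, v) \<in> tarcs A"
        using rooted_tree_ex_parent[OF A] by blast
      moreover have "u \<noteq> g"
        using calculation False gh' by blast
      ultimately show ?thesis
        unfolding arcsB using False \<open>v \<noteq> g\<close> parent_unique[OF A] by blast
    qed
  qed
qed

lemma contract_steps_props:
  assumes "contract_step\<^sup>*\<^sup>* A B" and A: "rooted_tree A"
  shows "rooted_tree B \<and> tverts B \<subseteq> tverts A \<and>
    (\<forall>v\<in>tverts B. outdegree B v = outdegree A v) \<and>
    (\<forall>v\<in>tverts A - tverts B. outdegree A v = 1) \<and>
    (\<forall>u\<in>tverts B. \<forall>v\<in>tverts B. (u, v) \<in> (tarcs B)\<^sup>* \<longleftrightarrow> (u, v) \<in> (tarcs A)\<^sup>*)"
  using assms(1)
proof (induction rule: rtranclp_induct)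
  case base
  then show ?case
    using A by simp
next
  case (step B C)
  note p = contract_step_props[OF step(2)]
  have B: "rooted_tree B"
    using step.IH by blast
  have "tverts C \<subseteq> tverts B"
    using p(3)[OF B] by blast
  then show ?case
    using step.IH p(1)[OF B] p(4)[OF B] p(5)[OF B] p(6)[OF B]
    by (intro conjI) (blast, blast, metis subsetD, metis Diff_iff, metis subsetD)
qed

text \<open>Each contraction lowers the number of vertices. The assumption on the root persists, and
  it guarantees that a vertex of outdegree 1 always has a parent, as a contraction requires.\<close>

lemma ex_contracted:
  assumes "rooted_tree A" "outdegree A (troot A) \<noteq> 1"
  shows "\<exists>B. contract_step\<^sup>*\<^sup>* A B \<and> (\<forall>v\<in>tverts B. outdegree B v \<noteq> 1)"
  using assms
proof (induction "card (tverts A)" arbitrary: A rule: less_induct)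
  case less
  show ?case
  proof (cases "\<forall>v\<in>tverts A. outdegree A v \<noteq> 1")
    case True
    then show ?thesis
      by blast
  next
    case False
    then obtain g where g: "g \<in> tverts A" "outdegree A g = 1"
      by blast
    then obtain h where "children A g = {h}"
      by (auto simp: outdegree_def card_1_singleton_iff)
    moreover obtain f where "(f, g) \<in> tarcs A"
      using g less.prems rooted_tree_ex_parent by metis
    ultimately obtain C where C: "contract_step A C"
      by (meson contract_step.intros)
    note p = contract_step_props[OF C less.prems(1)]
    have "card (tverts C) < card (tverts A)"
      using p(3) rooted_tree_finite[OF less.prems(1)] by (rule psubset_card_mono[rotated])
    moreover have "outdegree C (troot C) \<noteq> 1"
      using p(2) p(4)[of "troot C"] rooted_tree_root[OF p(1)] less.prems(2) by simp
    ultimately obtain B where "contract_step\<^sup>*\<^sup>* C B" "\<forall>v\<in>tverts B. outdegree B v \<noteq> 1"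
      using less.hyps p(1) by blast
    then show ?thesis
      using C by (meson converse_rtranclp_into_rtranclp)
  qed
qed

section \<open>Leaf-induced subtrees\<close>

text \<open>Common ancestors all lie above one leaf of \<open>S\<close>, so they are pairwise
  comparable and a deepest one is below all others. This shows that the description in
  \<open>mrca\<close> is well-defined.\<close>

lemma mrca_props:
  assumes T: "rooted_tree T" and S: "S \<noteq> {}" "S \<subseteq> leaves T"
  shows "mrca T S \<in> common_ancestors T S"
    and "a \<in> common_ancestors T S \<Longrightarrow> (a, mrca T S) \<in> (tarcs T)\<^sup>*"
proof -
  let ?C = "common_ancestors T S"
  have fin: "finite ?C"
    using rooted_tree_finite[OF T] by (simp add: common_ancestors_def)
  have "troot T \<in> ?C"
    using S rooted_tree_root[OF T] rooted_tree_root_reach[OF T]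
    by (auto simp: common_ancestors_def leaves_def)
  then obtain m where m: "m \<in> ?C" "\<And>w. w \<in> ?C \<Longrightarrow> depth T w \<le> depth T m"
    using ex_max_depth[OF fin] by blast
  have "(a, m) \<in> (tarcs T)\<^sup>*" if "a \<in> ?C" for a
  proof -
    obtain s where "s \<in> S"
      using S by blast
    then have "comparable T a m"
      using that m(1) ancestors_comparable[OF T] by (auto simp: common_ancestors_def)
    then show ?thesis
      using m(2)[OF that] depth_reach[OF T, of m a] by (auto simp: comparable_def)
  qed
  note below = this
  have "mrca T S = m"
    unfolding mrca_def
  proof (rule the_equality)
    show "x = m" if "x \<in> ?C \<and> (\<forall>a\<in>?C. (a, x) \<in> (tarcs T)\<^sup>*)" for x
      using that m(1) below by (intro reach_antisym[OF T]) auto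
  qed (use m(1) below in blast)
  then show "mrca T S \<in> ?C" "a \<in> ?C \<Longrightarrow> (a, mrca T S) \<in> (tarcs T)\<^sup>*"
    using m(1) below by simp_all
qed

lemma spanned_subtree_props:
  assumes T: "rooted_tree T" and S: "S \<noteq> {}" "S \<subseteq> leaves T"
  defines "A \<equiv> spanned_subtree T S"
  shows "rooted_tree A" and "tverts A \<subseteq> tverts T"
    and "v \<in> tverts A \<Longrightarrow> children A v = {w \<in> children T v. \<exists>s\<in>S. (w, s) \<in> (tarcs T)\<^sup>*}"
    and "u \<in> tverts A \<Longrightarrow> v \<in> tverts A \<Longrightarrow> (u, v) \<in> (tarcs A)\<^sup>* \<longleftrightarrow> (u, v) \<in> (tarcs T)\<^sup>*"
    and "leaves A = S"
    and "outdegree A (troot A) \<noteq> 1"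
    and "separates T u a b \<Longrightarrow> a \<in> S \<Longrightarrow> b \<in> S \<Longrightarrow> u \<in> tverts A"
proof -
  define m where "m = mrca T S"
  have m: "m \<in> tverts T" "\<And>s. s \<in> S \<Longrightarrow> (m, s) \<in> (tarcs T)\<^sup>*"
    "\<And>a. a \<in> tverts T \<Longrightarrow> (\<And>s. s \<in> S \<Longrightarrow> (a, s) \<in> (tarcs T)\<^sup>*) \<Longrightarrow> (a, m) \<in> (tarcs T)\<^sup>*"
    using mrca_props[OF T S] by (auto simp: m_def common_ancestors_def)
  have rA: "troot A = m"
    by (simp add: A_def m_def spanned_subtree_def)
  have vA: "v \<in> tverts A \<longleftrightarrow> (m, v) \<in> (tarcs T)\<^sup>* \<and> (\<exists>s\<in>S. (v, s) \<in> (tarcs T)\<^sup>*)" for v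
    using reach_verts[OF T] m(1) by (auto simp: A_def m_def spanned_subtree_def)
  \<comment> \<open>The definition restricts \<open>u\<close> only from above and \<open>v\<close>
    only from below; the other two restrictions follow along the arc, so the spanned subtree keeps
    every arc of \<open>T\<close> between its vertices.\<close>
  have aA: "(u, v) \<in> tarcs A \<longleftrightarrow> (u, v) \<in> tarcs T \<and> u \<in> tverts A \<and> v \<in> tverts A" for u v
    unfolding vA by (simp add: A_def m_def spanned_subtree_def)
      (blast intro: rtrancl_into_rtrancl converse_rtrancl_into_rtrancl)
  show verts: "tverts A \<subseteq> tverts T"
    by (auto simp: A_def spanned_subtree_def)
  show ch: "children A v = {w \<in> children T v. \<exists>s\<in>S. (w, s) \<in> (tarcs T)\<^sup>*}" if "v \<in> tverts A" for v
    using that by (auto simp: children_def aA vA intro: rtrancl_into_rtrancl)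
  show reach: "(u, v) \<in> (tarcs A)\<^sup>* \<longleftrightarrow> (u, v) \<in> (tarcs T)\<^sup>*" if "u \<in> tverts A" "v \<in> tverts A" for u v
  proof
    assume "(u, v) \<in> (tarcs A)\<^sup>*"
    moreover have "tarcs A \<subseteq> tarcs T"
      using aA by auto
    ultimately show "(u, v) \<in> (tarcs T)\<^sup>*"
      using rtrancl_mono by blast
  next
    assume "(u, v) \<in> (tarcs T)\<^sup>*"
    then show "(u, v) \<in> (tarcs A)\<^sup>*"
      using that(2)
    proof (induction rule: rtrancl_induct)
      case (step y z)
      have "y \<in> tverts A"
        using step that(1) unfolding vA by (meson converse_rtrancl_into_rtrancl rtrancl_trans)
      with step show ?case
        by (auto simp: aA intro: rtrancl_into_rtrancl)
    qed simp
  qed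
  show R: "rooted_tree A"
    unfolding rooted_tree_def
  proof (intro conjI ballI allI)
    show "finite (tverts A)"
      using verts rooted_tree_finite[OF T] by (rule finite_subset)
    show root: "troot A \<in> tverts A"
      using S m(2) unfolding rA vA by auto
    show "tarcs A \<subseteq> tverts A \<times> tverts A"
      using aA by auto
    show "(u, troot A) \<notin> tarcs A" for u
      using arc_not_reach_back[OF T, of u m] unfolding rA aA vA by blast
    show "(troot A, v) \<in> (tarcs A)\<^sup>*" if "v \<in> tverts A" for v
      using reach[OF root that] that by (simp add: rA vA)
    show "\<exists>!u. (u, v) \<in> tarcs A" if v: "v \<in> tverts A - {troot A}" for v
    proof -
      have "(m, v) \<in> (tarcs T)\<^sup>*" "m \<noteq> v"
        using v by (auto simp: vA rA)
      then obtain u where "(m, u) \<in> (tarcs T)\<^sup>*" "(u, v) \<in> tarcs T"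
        by (metis rtranclE)
      moreover from this have "u \<in> tverts A"
        using v converse_rtrancl_into_rtrancl[of u v "tarcs T"] by (auto simp: vA)
      ultimately have "(u, v) \<in> tarcs A"
        using v by (simp add: aA)
      then show ?thesis
        using parent_unique[OF T] by (auto simp: aA)
    qed
  qed
  show "leaves A = S"
  proof (intro equalityI subsetI)
    fix v assume "v \<in> leaves A"
    then have v: "v \<in> tverts A" "\<And>w. (v, w) \<notin> tarcs A"
      by (auto simp: leaves_iff[OF R])
    obtain s where s: "s \<in> S" "(v, s) \<in> (tarcs T)\<^sup>*"
      using v(1) by (auto simp: vA)
    then have "s \<in> tverts A"
      using m(2) by (auto simp: vA)
    then have "(v, s) \<in> (tarcs A)\<^sup>*"
      using s(2) v(1) reach by simp
    then show "v \<in> S"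
      using v(2) s(1) by (metis converse_rtranclE)
  next
    fix s assume "s \<in> S"
    then show "s \<in> leaves A"
      using S m(2) by (auto simp: leaves_iff[OF R] leaves_iff[OF T] vA aA)
  qed
  \<comment> \<open>A single child of the root would be above all of \<open>S\<close>, hence a
    common ancestor strictly below the most recent one.\<close>
  show "outdegree A (troot A) \<noteq> 1"
  proof
    assume "outdegree A (troot A) = 1"
    then obtain x where x: "children A m = {x}"
      by (auto simp: outdegree_def rA card_1_singleton_iff)
    then have mx: "(m, x) \<in> tarcs T"
      by (auto simp: children_def aA)
    have "(x, s) \<in> (tarcs T)\<^sup>*" if s: "s \<in> S" for s
    proof -
      have "m \<noteq> s"
        using mx s S by (auto simp: leaves_iff[OF T])
      then obtain z where z: "(m, z) \<in> tarcs T" "(z, s) \<in> (tarcs T)\<^sup>*"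
        using m(2)[OF s] by (meson converse_rtranclE)
      then have "z \<in> children A m"
        using s m(2) ch[of m] by (auto simp: children_def vA)
      then show ?thesis
        using x z(2) by simp
    qed
    then have "(x, m) \<in> (tarcs T)\<^sup>*"
      using m(3) arc_verts[OF T mx] by blast
    then show False
      using arc_not_reach_back[OF T mx] by simp
  qed
  show "u \<in> tverts A" if "separates T u a b" "a \<in> S" "b \<in> S"
    using separates_below[OF T that(1) m(2) m(2)] that separates_reach(1)[OF that(1)]
    by (auto simp: vA)
qed

text \<open>The only interface to contraction used later. The right-hand sides refer to
  \<open>T\<close> and \<open>S\<close> alone, so nothing depends on which contraction sequence
  produced \<open>B\<close>.\<close>

lemma leaf_induced_props:
  assumes T: "rooted_tree T" and S: "S \<noteq> {}" "S \<subseteq> leaves T"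
    and B: "leaf_induced_subtree T S B"
  shows "topological_tree B" and "leaves B = S"
    and "internals B = {u. \<exists>a\<in>S. \<exists>b\<in>S. separates T u a b}"
    and "v \<in> tverts B \<Longrightarrow> outdegree B v \<le> outdegree T v"
    and "tverts B \<subseteq> tverts T"
    and "u \<in> tverts B \<Longrightarrow> v \<in> tverts B \<Longrightarrow> (u, v) \<in> (tarcs B)\<^sup>* \<longleftrightarrow> (u, v) \<in> (tarcs T)\<^sup>*"
proof -
  define A where "A = spanned_subtree T S"
  note A = spanned_subtree_props[OF T S, folded A_def]
  have *: "contract_step\<^sup>*\<^sup>* A B" and B1: "\<forall>v\<in>tverts B. outdegree B v \<noteq> 1"
    using B by (auto simp: leaf_induced_subtree_def A_def)
  note p = contract_steps_props[OF * A(1)]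
  show "topological_tree B"
    using p B1 by (auto simp: topological_tree_def)
  \<comment> \<open>Removed vertices had outdegree 1; kept ones have the same outdegree as in
    \<open>B\<close>, where 1 no longer occurs.\<close>
  have vB: "tverts B = {v \<in> tverts A. outdegree A v \<noteq> 1}"
    using p B1 by auto
  show lB: "leaves B = S"
  proof -
    have "v \<in> leaves B \<longleftrightarrow> v \<in> leaves A" for v
    proof -
      have "outdegree B v = outdegree A v" if "v \<in> tverts B"
        using p that by blast
      then show ?thesis
        unfolding leaves_def vB by auto
    qed
    then show ?thesis
      using A(5) by blast
  qed
  show "tverts B \<subseteq> tverts T"
    using p A(2) by blast
  show "(u, v) \<in> (tarcs B)\<^sup>* \<longleftrightarrow> (u, v) \<in> (tarcs T)\<^sup>*" if "u \<in> tverts B" "v \<in> tverts B" for u v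
  proof -
    have "u \<in> tverts A" "v \<in> tverts A" "(u, v) \<in> (tarcs B)\<^sup>* \<longleftrightarrow> (u, v) \<in> (tarcs A)\<^sup>*"
      using that p by blast+
    then show ?thesis
      using A(4) by simp
  qed
  show "outdegree B v \<le> outdegree T v" if "v \<in> tverts B"
  proof -
    have "outdegree B v = outdegree A v" "v \<in> tverts A"
      using that p by auto
    then show ?thesis
      using A(3)[of v] finite_children[OF T, of v] by (auto simp: outdegree_def intro: card_mono)
  qed
  show "internals B = {u. \<exists>a\<in>S. \<exists>b\<in>S. separates T u a b}"
  proof (intro equalityI subsetI)
    fix u assume "u \<in> internals B"
    then have u: "u \<in> tverts A" "\<not> card (children A u) \<le> Suc 0"
      using p B1 by (auto simp: internals_def leaves_def outdegree_def le_Suc_eq)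
    then obtain x y where "x \<in> children A u" "y \<in> children A u" "x \<noteq> y"
      using card_le_Suc0_iff_eq[OF finite_children[OF A(1)]] by blast
    then show "u \<in> {u. \<exists>a\<in>S. \<exists>b\<in>S. separates T u a b}"
      unfolding A(3)[OF u(1)] unfolding separates_def children_def by blast
  next
    fix u assume "u \<in> {u. \<exists>a\<in>S. \<exists>b\<in>S. separates T u a b}"
    then obtain a b where ab: "a \<in> S" "b \<in> S" "separates T u a b"
      by blast
    then have u: "u \<in> tverts A"
      using A(7) by blast
    obtain x y where "x \<noteq> y" "x \<in> children A u" "y \<in> children A u"
      using ab unfolding A(3)[OF u] unfolding separates_def children_def by blast
    then have "\<not> card (children A u) \<le> Suc 0"
      using card_le_Suc0_iff_eq[OF finite_children[OF A(1)]] by blast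
    then show "u \<in> internals B"
      using u p vB by (auto simp: internals_def leaves_def outdegree_def)
  qed
qed

lemma ex_leaf_induced_subtree:
  assumes "rooted_tree T" "S \<noteq> {}" "S \<subseteq> leaves T"
  shows "\<exists>B. leaf_induced_subtree T S B"
  unfolding leaf_induced_subtree_def
  using ex_contracted spanned_subtree_props(1,6) assms by metis

text \<open>Induced subtrees are concrete records over the vertices of \<open>T\<close>. Finiteness
  matters because \<open>card\<close> of an infinite set is 0.\<close>

lemma finite_leaf_induced_subtrees:
  assumes T: "rooted_tree T" shows "finite (leaf_induced_subtrees T)"
proof (rule finite_subset)
  let ?V = "tverts T"
  let ?F = "\<lambda>(V, r, E). \<lparr>tverts = V, troot = r, tarcs = E\<rparr>"
  show "finite (?F ` (Pow ?V \<times> ?V \<times> Pow (?V \<times> ?V)))"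
    using rooted_tree_finite[OF T] by blast
  show "leaf_induced_subtrees T \<subseteq> ?F ` (Pow ?V \<times> ?V \<times> Pow (?V \<times> ?V))"
  proof
    fix B assume "B \<in> leaf_induced_subtrees T"
    then obtain S where "S \<noteq> {}" "S \<subseteq> leaves T" "leaf_induced_subtree T S B"
      by (auto simp: leaf_induced_subtrees_def)
    note p = leaf_induced_props[OF T this]
    note R = topological_treeD[OF p(1)]
    have "(tverts B, troot B, tarcs B) \<in> Pow ?V \<times> ?V \<times> Pow (?V \<times> ?V)"
      using p(5) rooted_tree_root[OF R] rooted_tree_arcs[OF R] by auto
    moreover have "B = ?F (tverts B, troot B, tarcs B)"
      by simp
    ultimately show "B \<in> ?F ` (Pow ?V \<times> ?V \<times> Pow (?V \<times> ?V))"
      by (rule rev_image_eqI)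
  qed
qed

section \<open>Isomorphism\<close>

lemma rtree_iso_refl: "rtree_iso A A"
  unfolding rtree_iso_def by (rule exI[of _ id]) auto

lemma rtree_iso_sym:
  assumes "rooted_tree A" "rtree_iso A B" shows "rtree_iso B A"
proof -
  obtain f where f: "bij_betw f (tverts A) (tverts B)" "f (troot A) = troot B"
    "\<forall>u\<in>tverts A. \<forall>v\<in>tverts A. (u, v) \<in> tarcs A \<longleftrightarrow> (f u, f v) \<in> tarcs B"
    using assms(2) by (auto simp: rtree_iso_def)
  let ?g = "inv_into (tverts A) f"
  have "bij_betw ?g (tverts B) (tverts A)"
    using f(1) by (rule bij_betw_inv_into)
  moreover have "?g (troot B) = troot A"
    using f rooted_tree_root[OF assms(1)] by (metis bij_betw_inv_into_left)
  moreover have "(u, v) \<in> tarcs B \<longleftrightarrow> (?g u, ?g v) \<in> tarcs A"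
    if "u \<in> tverts B" "v \<in> tverts B" for u v
    using that f(3) bij_betw_apply[OF calculation(1)] bij_betw_inv_into_right[OF f(1)] by simp
  ultimately show ?thesis
    unfolding rtree_iso_def by blast
qed

lemma rtree_iso_trans:
  assumes "rtree_iso A B" "rtree_iso B C" shows "rtree_iso A C"
proof -
  obtain f where f: "bij_betw f (tverts A) (tverts B)" "f (troot A) = troot B"
    "\<forall>u\<in>tverts A. \<forall>v\<in>tverts A. (u, v) \<in> tarcs A \<longleftrightarrow> (f u, f v) \<in> tarcs B"
    using assms(1) by (auto simp: rtree_iso_def)
  obtain g where g: "bij_betw g (tverts B) (tverts C)" "g (troot B) = troot C"
    "\<forall>u\<in>tverts B. \<forall>v\<in>tverts B. (u, v) \<in> tarcs B \<longleftrightarrow> (g u, g v) \<in> tarcs C"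
    using assms(2) by (auto simp: rtree_iso_def)
  show ?thesis
    unfolding rtree_iso_def using f g bij_betw_trans[OF f(1) g(1)]
    by (intro exI[of _ "g \<circ> f"]) (auto dest: bij_betwE)
qed

text \<open>The caterpillar condition without an enumeration of the path: in this form it passes to
  induced subtrees and is invariant under isomorphism.\<close>

definition internals_chain :: "'a rtree \<Rightarrow> bool" where
  "internals_chain T \<longleftrightarrow> (\<forall>u\<in>internals T. \<forall>v\<in>internals T. comparable T u v)"

lemma rtree_iso_invariants:
  assumes A: "rooted_tree A" and B: "rooted_tree B" and "rtree_iso A B"
  shows "card (internals A) = card (internals B)"
    and "card (leaves A) = card (leaves B)"
    and "internals_chain A \<Longrightarrow> internals_chain B"
proof -
  obtain f where f: "bij_betw f (tverts A) (tverts B)"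
    "\<And>u v. u \<in> tverts A \<Longrightarrow> v \<in> tverts A \<Longrightarrow> (u, v) \<in> tarcs A \<longleftrightarrow> (f u, f v) \<in> tarcs B"
    using assms(3) by (auto simp: rtree_iso_def)
  have im: "f ` tverts A = tverts B" and inj: "inj_on f (tverts A)"
    using f(1) by (auto simp: bij_betw_def)
  have ints: "f ` internals A = internals B"
  proof (intro equalityI subsetI)
    fix y assume "y \<in> f ` internals A"
    then obtain u v where uv: "y = f u" "(u, v) \<in> tarcs A"
      by (auto simp: internals_iff[OF A])
    then have "(f u, f v) \<in> tarcs B"
      using f(2) arc_verts[OF A uv(2)] by simp
    then show "y \<in> internals B"
      using uv(1) by (auto simp: internals_iff[OF B])
  next
    fix y assume "y \<in> internals B"
    then obtain z where z: "(y, z) \<in> tarcs B"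
      by (auto simp: internals_iff[OF B])
    then obtain u v where "u \<in> tverts A" "v \<in> tverts A" "y = f u" "z = f v"
      using arc_verts[OF B z] im by blast
    then show "y \<in> f ` internals A"
      using z f(2) internals_iff[OF A] by blast
  qed
  show c: "card (internals A) = card (internals B)"
    using ints inj internals_subset[of A] by (metis card_image inj_on_subset)
  show "card (leaves A) = card (leaves B)"
    using c card_verts[OF A] card_verts[OF B] bij_betw_same_card[OF f(1)] by simp
  \<comment> \<open>One direction suffices, since the chain property is only carried from
    \<open>A\<close> to \<open>B\<close>.\<close>
  have reach: "(f u, f v) \<in> (tarcs B)\<^sup>*" if "(u, v) \<in> (tarcs A)\<^sup>*" for u v
    using that
  proof (induction rule: rtrancl_induct)
    case (step y z)
    then show ?case
      using f(2) arc_verts[OF A step(2)] by (auto intro: rtrancl_into_rtrancl)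
  qed simp
  show "internals_chain B" if "internals_chain A"
    unfolding internals_chain_def ints[symmetric]
    using that reach by (auto simp: internals_chain_def comparable_def)
qed

section \<open>Classification of trees whose internal vertices form a chain\<close>

lemma ex_bij_betw_fibres:
  assumes "finite A" "finite B"
    and "\<And>k. card {a \<in> A. g a = k} = card {b \<in> B. h b = k}"
  shows "\<exists>f. bij_betw f A B \<and> (\<forall>a\<in>A. h (f a) = g a)"
proof -
  have "\<exists>f. bij_betw f {a \<in> A. g a = k} {b \<in> B. h b = k}" for k
    using assms by (intro finite_same_card_bij) auto
  then obtain F where F: "\<And>k. bij_betw (F k) {a \<in> A. g a = k} {b \<in> B. h b = k}"
    by metis
  \<comment> \<open>The bijections between fibres are glued; as the fibres are disjoint on both
    sides, the result is a bijection.\<close>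
  let ?f = "\<lambda>a. F (g a) a"
  have im: "?f a \<in> B \<and> h (?f a) = g a" if "a \<in> A" for a
    using F[of "g a"] that by (auto dest: bij_betwE)
  have "inj_on ?f A"
  proof (rule inj_onI)
    fix a b assume ab: "a \<in> A" "b \<in> A" "?f a = ?f b"
    then have "g a = g b"
      using im by metis
    then show "a = b"
      using ab F[of "g a"] by (auto simp: bij_betw_def inj_on_def)
  qed
  moreover have "b \<in> ?f ` A" if "b \<in> B" for b
  proof -
    have "b \<in> F (h b) ` {a \<in> A. g a = h b}"
      using F[of "h b"] that by (auto simp: bij_betw_def)
    then obtain a where "a \<in> A" "g a = h b" "b = F (h b) a"
      by blast
    then show ?thesis
      by (intro image_eqI[of _ _ a]) simp_all
  qed
  ultimately have "bij_betw ?f A B"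
    using im by (auto simp: bij_betw_def)
  then show ?thesis
    using im by blast
qed

lemma down_closed_eq_lessThan:
  fixes A :: "nat set"
  assumes "finite A" "\<And>i. Suc i \<in> A \<Longrightarrow> i \<in> A"
  shows "A = {..<card A}"
proof (cases "A = {}")
  case False
  have "i \<in> A" if "i \<le> Max A" for i
    using that
  proof (induction rule: inc_induct)
    case base
    then show ?case
      using False assms(1) by simp
  next
    case (step i)
    then show ?case
      using assms(2) by blast
  qed
  then have "A = {..Max A}"
    using assms(1) by auto
  then have "card A = Suc (Max A)"
    by (metis card_atMost)
  then show ?thesis
    using \<open>A = {..Max A}\<close> lessThan_Suc_atMost by metis
qed simp

lemma chain_depth_inj:
  assumes "rooted_tree T" "internals_chain T"
  shows "inj_on (depth T) (internals T)"
  using assms depth_reach[OF assms(1)]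
  unfolding inj_on_def internals_chain_def comparable_def by (metis less_irrefl)

text \<open>A vertex of positive depth has an internal parent one level higher, and a chain has at
  most one internal vertex per level, so the parent is forced.\<close>

lemma chain_arc_iff:
  assumes T: "rooted_tree T" and ch: "internals_chain T"
  shows "(u, v) \<in> tarcs T \<longleftrightarrow> u \<in> internals T \<and> v \<in> tverts T \<and> depth T v = Suc (depth T u)"
proof
  assume "(u, v) \<in> tarcs T"
  then show "u \<in> internals T \<and> v \<in> tverts T \<and> depth T v = Suc (depth T u)"
    using depth_arc[OF T] arc_verts[OF T] by (auto simp: internals_iff[OF T])
next
  assume r: "u \<in> internals T \<and> v \<in> tverts T \<and> depth T v = Suc (depth T u)"
  then obtain p where p: "(p, v) \<in> tarcs T"
    using rooted_tree_ex_parent[OF T] depth_eq_0_iff[OF T] by (metis nat.distinct(1))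
  then have "p \<in> internals T" "depth T p = depth T u"
    using r depth_arc[OF T p] by (auto simp: internals_iff[OF T])
  then have "p = u"
    using chain_depth_inj[OF T ch] r by (auto dest: inj_onD)
  then show "(u, v) \<in> tarcs T"
    using p by simp
qed

lemma chain_depths:
  assumes T: "rooted_tree T" and ch: "internals_chain T"
  shows "depth T ` internals T = {..<card (internals T)}"
proof -
  have "i \<in> depth T ` internals T" if i: "Suc i \<in> depth T ` internals T" for i
  proof -
    obtain v where v: "v \<in> internals T" "depth T v = Suc i"
      using i by auto
    then obtain p where p: "(p, v) \<in> tarcs T"
      using rooted_tree_ex_parent[OF T] depth_eq_0_iff[OF T] internals_subset[of T]
      by (metis nat.distinct(1) subsetD)
    then show ?thesis
      using depth_arc[OF T p] v internals_iff[OF T] by (metis image_eqI nat.inject)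
  qed
  then have "depth T ` internals T = {..<card (depth T ` internals T)}"
    by (intro down_closed_eq_lessThan) (auto simp: finite_internals[OF T])
  then show ?thesis
    using card_image[OF chain_depth_inj[OF T ch]] by simp
qed

text \<open>Level 0 holds the root, and each further level consists of the children of the single
  internal vertex one level higher. Hence internal vertices occupy depths below
  \<open>card (internals T)\<close>, while vertices occur one level deeper: the bound is
  \<open><\<close> in the first count and \<open>\<le>\<close> in the second.\<close>

lemma chain_fibres:
  assumes T: "rooted_tree T" and ch: "internals_chain T"
    and d: "\<And>v. v \<in> internals T \<Longrightarrow> outdegree T v = d"
  shows "card {v \<in> internals T. depth T v = i} = (if i < card (internals T) then 1 else 0)"
    and "card {v \<in> tverts T. depth T v = i} =
      (if i = 0 then 1 else if i \<le> card (internals T) then d else 0)"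
proof -
  show "card {v \<in> internals T. depth T v = i} = (if i < card (internals T) then 1 else 0)" for i
  proof (cases "i < card (internals T)")
    case True
    then obtain u where u: "u \<in> internals T" "depth T u = i"
      using chain_depths[OF T ch] by (metis imageE lessThan_iff)
    then have "{v \<in> internals T. depth T v = i} = {u}"
      using chain_depth_inj[OF T ch] by (auto dest: inj_onD)
    then show ?thesis
      using True by simp
  next
    case False
    then have "{v \<in> internals T. depth T v = i} = {}"
      using chain_depths[OF T ch] by auto
    then show ?thesis
      using False by (simp only: if_False card.empty)
  qed
  show "card {v \<in> tverts T. depth T v = i} =
      (if i = 0 then 1 else if i \<le> card (internals T) then d else 0)"
  proof (cases i)
    case 0
    then have "{v \<in> tverts T. depth T v = i} = {troot T}"
      using depth_eq_0_iff[OF T] rooted_tree_root[OF T] by auto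
    then show ?thesis
      using 0 by simp
  next
    case (Suc j)
    show ?thesis
    proof (cases "j < card (internals T)")
      case True
      then obtain u where u: "u \<in> internals T" "depth T u = j"
        using chain_depths[OF T ch] by (metis imageE lessThan_iff)
      then have "{v \<in> tverts T. depth T v = i} = children T u"
        using Suc by (auto simp: children_def chain_arc_iff[OF T ch])
      then show ?thesis
        using True Suc d[OF u(1)] by (simp add: outdegree_def)
    next
      case False
      have "j < card (internals T)" if v: "v \<in> tverts T" "depth T v = i" for v
      proof -
        obtain p where p: "(p, v) \<in> tarcs T"
          using v Suc rooted_tree_ex_parent[OF T] depth_eq_0_iff[OF T] by (metis nat.distinct(1))
        then have "p \<in> internals T" "depth T p = j"
          using v Suc depth_arc[OF T p] by (auto simp: internals_iff[OF T])
        then show ?thesis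
          using chain_depths[OF T ch] by auto
      qed
      then have "{v \<in> tverts T. depth T v = i} = {}"
        using False by blast
      then have "card {v \<in> tverts T. depth T v = i} = 0"
        by (simp only: card.empty)
      then show ?thesis
        using False Suc by simp
    qed
  qed
qed

text \<open>When the internal vertices form a chain, arcs are read off from depths, so that a bijection
  preserving depth and internality is an isomorphism.\<close>

lemma chain_iso:
  assumes A: "rooted_tree A" "internals_chain A" "\<And>v. v \<in> internals A \<Longrightarrow> outdegree A v = d"
    and B: "rooted_tree B" "internals_chain B" "\<And>v. v \<in> internals B \<Longrightarrow> outdegree B v = d"
    and k: "card (internals A) = card (internals B)"
  shows "rtree_iso A B"
proof -
  let ?g = "\<lambda>v. (depth A v, v \<in> internals A)" and ?h = "\<lambda>v. (depth B v, v \<in> internals B)"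
  \<comment> \<open>The leaves of a level are its vertices minus its internal ones. The count
    involves only \<open>d\<close> and the number of internal vertices, which \<open>A\<close> and
    \<open>B\<close> share.\<close>
  have count: "card {v \<in> tverts T. (depth T v, v \<in> internals T) = (i, b)} =
      (let m = if i < card (internals T) then 1 else 0;
           l = if i = 0 then 1 else if i \<le> card (internals T) then d else 0
       in if b then m else l - m)"
    if T: "rooted_tree T" "internals_chain T" "\<And>v. v \<in> internals T \<Longrightarrow> outdegree T v = d"
    for T :: "'c rtree" and i b
  proof -
    have "{v \<in> tverts T. (depth T v, v \<in> internals T) = (i, True)} = {v \<in> internals T. depth T v = i}"
      using internals_subset[of T] by auto
    moreover have "{v \<in> tverts T. (depth T v, v \<in> internals T) = (i, False)} =
        {v \<in> tverts T. depth T v = i} - {v \<in> internals T. depth T v = i}"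
      using internals_subset[of T] by auto
    moreover have "card ({v \<in> tverts T. depth T v = i} - {v \<in> internals T. depth T v = i}) =
        card {v \<in> tverts T. depth T v = i} - card {v \<in> internals T. depth T v = i}"
      using internals_subset[of T] finite_internals[OF T(1)] by (intro card_Diff_subset) auto
    ultimately show ?thesis
      using chain_fibres[OF T, where i = i] by (cases b) (simp_all add: Let_def)
  qed
  have "\<exists>f. bij_betw f (tverts A) (tverts B) \<and> (\<forall>a\<in>tverts A. ?h (f a) = ?g a)"
  proof (rule ex_bij_betw_fibres[OF rooted_tree_finite[OF A(1)] rooted_tree_finite[OF B(1)]])
    show "card {a \<in> tverts A. ?g a = c} = card {b \<in> tverts B. ?h b = c}" for c
      using count[OF A, of "fst c" "snd c"] count[OF B, of "fst c" "snd c"] k by simp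
  qed
  then obtain f where f: "bij_betw f (tverts A) (tverts B)"
    "\<And>a. a \<in> tverts A \<Longrightarrow> depth B (f a) = depth A a"
    "\<And>a. a \<in> tverts A \<Longrightarrow> f a \<in> internals B \<longleftrightarrow> a \<in> internals A"
    by auto
  have fB: "f a \<in> tverts B" if "a \<in> tverts A" for a
    using f(1) that by (rule bij_betw_apply)
  have "f (troot A) = troot B"
    using f(2) fB rooted_tree_root[OF A(1)] depth_eq_0_iff A(1) B(1) by metis
  then show ?thesis
    unfolding rtree_iso_def using f fB
    by (intro exI[of _ f]) (auto simp: chain_arc_iff[OF A(1,2)] chain_arc_iff[OF B(1,2)])
qed

text \<open>Counting vertices in two ways gives leaves = 1 + internals * (d - 1). For
  \<open>d \<ge> 2\<close> this makes the leaf count determine the number of internal vertices; for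
  smaller \<open>d\<close> a topological tree has no internal vertex.\<close>

lemma uniform_chain_iso:
  assumes A: "topological_tree A" "internals_chain A" "\<And>v. v \<in> internals A \<Longrightarrow> outdegree A v = d"
    and B: "topological_tree B" "internals_chain B" "\<And>v. v \<in> internals B \<Longrightarrow> outdegree B v = d"
    and leaves: "card (leaves A) = card (leaves B)"
  shows "rtree_iso A B"
proof -
  note RA = topological_treeD[OF A(1)] and RB = topological_treeD[OF B(1)]
  have "(\<Sum>v\<in>internals A. outdegree A v) = card (internals A) * d"
    using A(3) by simp
  then have eqA: "card (leaves A) + card (internals A) = Suc (card (internals A) * d)"
    using card_verts[OF RA] card_verts_eq_sum_outdegree[OF RA] by simp
  have "(\<Sum>v\<in>internals B. outdegree B v) = card (internals B) * d"
    using B(3) by simp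
  then have eqB: "card (leaves B) + card (internals B) = Suc (card (internals B) * d)"
    using card_verts[OF RB] card_verts_eq_sum_outdegree[OF RB] by simp
  have "card (internals A) = card (internals B)"
  proof (cases "d \<ge> 2")
    case True
    then obtain e where e: "d = Suc (Suc e)"
      using le_Suc_ex by force
    have "card (leaves A) = Suc (card (internals A) * Suc e)"
      "card (leaves B) = Suc (card (internals B) * Suc e)"
      using eqA eqB unfolding e mult_Suc_right by linarith+
    then have "card (internals A) * Suc e = card (internals B) * Suc e"
      using leaves by linarith
    then show ?thesis
      by (metis mult_cancel2 nat.distinct(1))
  next
    case False
    have "v \<notin> internals A" for v
      using False outdegree_ge_2[OF A(1), of v] A(3)[of v] by auto
    moreover have "v \<notin> internals B" for v
      using False outdegree_ge_2[OF B(1), of v] B(3)[of v] by auto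
    ultimately have "internals A = {}" "internals B = {}"
      by blast+
    then show ?thesis
      by simp
  qed
  then show ?thesis
    using RA RB A(2,3) B(2,3) by (intro chain_iso)
qed

section \<open>Stars and caterpillars\<close>

lemma root_internal:
  assumes T: "rooted_tree T" and "card (leaves T) \<ge> 2"
  shows "troot T \<in> internals T"
proof (rule ccontr)
  assume "troot T \<notin> internals T"
  then have "troot T \<in> leaves T"
    using leaves_Un_internals(1)[of T] rooted_tree_root[OF T] by blast
  then have "tverts T \<subseteq> {troot T}"
    using leaf_reach[OF T] rooted_tree_root_reach[OF T] by blast
  then have "leaves T \<subseteq> {troot T}"
    by (auto simp: leaves_def)
  then have "card (leaves T) \<le> card {troot T}"
    by (intro card_mono) auto
  then show False
    using assms(2) by simp
qed

text \<open>An internal vertex other than the root of a star would lie below a leaf. Conversely, the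
  root is internal because \<open>n \<ge> 2\<close>, and if it is the only internal vertex then all
  other vertices are its children.\<close>

lemma star_tree_iff:
  assumes T: "rooted_tree T" and n: "card (leaves T) = n" "n \<ge> 2"
  shows "star_tree n T \<longleftrightarrow> card (internals T) = 1"
proof
  assume star: "star_tree n T"
  have "u = troot T" if u: "u \<in> internals T" for u
  proof (rule ccontr)
    assume "u \<noteq> troot T"
    moreover have "(troot T, u) \<in> (tarcs T)\<^sup>*"
      using u internals_subset[of T] rooted_tree_root_reach[OF T] by blast
    ultimately obtain z where z: "(troot T, z) \<in> tarcs T" "(z, u) \<in> (tarcs T)\<^sup>*"
      by (metis converse_rtranclE)
    then have "z \<in> leaves T"
      using star by (auto simp: star_tree_def children_def)
    then have "u \<in> leaves T"
      using leaf_reach[OF T _ z(2)] by simp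
    then show False
      using u leaves_Un_internals(2)[of T] by blast
  qed
  then have "internals T = {troot T}"
    using root_internal[OF T] n by blast
  then show "card (internals T) = 1"
    by simp
next
  assume "card (internals T) = 1"
  then obtain r where "internals T = {r}"
    by (auto simp: card_1_singleton_iff)
  then have I: "internals T = {troot T}"
    using root_internal[OF T] n by auto
  have "outdegree T (troot T) = n"
    using card_verts[OF T] card_verts_eq_sum_outdegree[OF T] n by (simp add: I)
  moreover have "w \<in> leaves T" if w: "w \<in> children T (troot T)" for w
  proof -
    have "(troot T, w) \<in> tarcs T"
      using w by (simp add: children_def)
    then have "w \<in> tverts T" "w \<noteq> troot T"
      using arc_verts[OF T] rooted_tree_root_no_parent[OF T] by blast+
    then show ?thesis
      using I leaves_Un_internals(1)[of T] by blast
  qed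
  ultimately show "star_tree n T"
    using T by (auto simp: star_tree_def)
qed

lemma caterpillar_chain:
  assumes "binary_caterpillar n T"
  shows "internals_chain T"
proof -
  obtain vs where vs: "set vs = internals T"
    and next_vs: "\<And>i. Suc i < length vs \<Longrightarrow> children T (vs ! i) \<inter> internals T = {vs ! Suc i}"
    using assms by (auto simp: binary_caterpillar_def)
  have arc: "(vs ! i, vs ! Suc i) \<in> tarcs T" if "Suc i < length vs" for i
    using next_vs[OF that] unfolding children_def by blast
  have reach: "(vs ! i, vs ! j) \<in> (tarcs T)\<^sup>*" if "i \<le> j" "j < length vs" for i j
    using that
  proof (induction rule: dec_induct)
    case (step k)
    then show ?case
      using arc[of k] by (auto intro: rtrancl_into_rtrancl)
  qed simp
  show ?thesis
    unfolding internals_chain_def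
  proof (intro ballI)
    fix u v assume "u \<in> internals T" "v \<in> internals T"
    then obtain i j where "u = vs ! i" "v = vs ! j" "i < length vs" "j < length vs"
      unfolding vs[symmetric] by (auto simp: in_set_conv_nth)
    then show "comparable T u v"
      using reach[of i j] reach[of j i] by (cases "i \<le> j") (auto simp: comparable_def)
  qed
qed

text \<open>In a chain the depths of the internal vertices are exactly the numbers below their
  count, so listing them by depth recovers the path.\<close>

lemma binary_caterpillar_iff:
  assumes T: "rooted_tree T"
  shows "binary_caterpillar n T \<longleftrightarrow>
    card (leaves T) = n \<and> (\<forall>v\<in>internals T. outdegree T v = 2) \<and> internals_chain T"
proof (intro iffI conjI)
  assume cat: "binary_caterpillar n T"
  show "card (leaves T) = n" "internals_chain T"
    using cat caterpillar_chain by (auto simp: binary_caterpillar_def)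
  show "\<forall>v\<in>internals T. outdegree T v = 2"
    using cat by (auto simp: binary_caterpillar_def internals_def leaves_def)
next
  assume r: "card (leaves T) = n \<and> (\<forall>v\<in>internals T. outdegree T v = 2) \<and> internals_chain T"
  then have ch: "internals_chain T" and deg: "\<And>v. v \<in> internals T \<Longrightarrow> outdegree T v = 2"
    by auto
  define k where "k = card (internals T)"
  \<comment> \<open>\<open>e i\<close> is the unique internal vertex at depth \<open>i\<close>, the
    entry at position \<open>i\<close> of the path.\<close>
  define e where "e = inv_into (internals T) (depth T)"
  have e: "e i \<in> internals T" "depth T (e i) = i" if "i < k" for i
  proof -
    have "i \<in> depth T ` internals T"
      using chain_depths[OF T ch] that by (simp add: k_def)
    then show "e i \<in> internals T" "depth T (e i) = i"
      unfolding e_def by (rule inv_into_into, rule f_inv_into_f)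
  qed
  have depth_less: "depth T v < k" if "v \<in> internals T" for v
    using chain_depths[OF T ch] that by (auto simp: k_def)
  have e_depth: "e (depth T v) = v" if "v \<in> internals T" for v
    unfolding e_def using chain_depth_inj[OF T ch] that by (rule inv_into_f_f)
  have card_leaf_children:
    "card (children T v \<inter> leaves T) = 2 - card (children T v \<inter> internals T)"
    if "v \<in> internals T" for v
  proof -
    have "children T v \<subseteq> tverts T"
      using arc_verts[OF T] by (auto simp: children_def)
    then have "children T v \<inter> leaves T = children T v - (children T v \<inter> internals T)"
      using leaves_Un_internals[of T] by blast
    then show ?thesis
      using deg[OF that] finite_children[OF T, of v] card_Diff_subset_Int[of "children T v" "internals T"]
      by (simp add: outdegree_def Diff_Int)
  qed
  have child_iff: "v \<in> children T (e i) \<inter> internals T \<longleftrightarrow> v \<in> internals T \<and> depth T v = Suc i"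
    if "i < k" for i v
    using e[OF that] internals_subset[of T] by (auto simp: children_def chain_arc_iff[OF T ch])
  let ?vs = "map e [0..<k]"
  have "distinct ?vs"
    using e(2) by (auto simp: distinct_map intro!: inj_onI) metis
  moreover have "set ?vs = internals T"
  proof (intro equalityI subsetI)
    fix v assume "v \<in> internals T"
    then show "v \<in> set ?vs"
      using depth_less[of v] e_depth[of v] by (auto intro!: image_eqI[of _ _ "depth T v"])
  qed (use e in auto)
  moreover have "hd ?vs = troot T" if "?vs \<noteq> []"
  proof -
    have "0 < k"
      using that by simp
    then have "e 0 = troot T"
      using e[of 0] internals_subset[of T] depth_eq_0_iff[OF T] by blast
    then show ?thesis
      using \<open>0 < k\<close> by (simp add: hd_map)
  qed
  moreover have "children T (?vs ! i) \<inter> internals T = {?vs ! Suc i} \<and>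
      card (children T (?vs ! i) \<inter> leaves T) = 1" if "Suc i < length ?vs" for i
  proof -
    have i: "i < k" "Suc i < k"
      using that by auto
    have "children T (e i) \<inter> internals T = {e (Suc i)}"
    proof (rule set_eqI)
      show "v \<in> children T (e i) \<inter> internals T \<longleftrightarrow> v \<in> {e (Suc i)}" for v
        unfolding child_iff[OF i(1)] using e[OF i(2)] e_depth[of v] by auto
    qed
    then show ?thesis
      using i card_leaf_children[OF e(1)[OF i(1)]] by simp
  qed
  moreover have "card (children T (last ?vs) \<inter> leaves T) = 2" if "?vs \<noteq> []"
  proof -
    have k: "k - 1 < k" "Suc (k - 1) = k"
      using that by auto
    then have "last ?vs = e (k - 1)"
      using that by (simp add: last_map last_upt)
    \<comment> \<open>Such a child would have depth \<open>k\<close>, one more than the deepest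
      internal vertex.\<close>
    moreover have "v \<notin> children T (e (k - 1)) \<inter> internals T" for v
      using child_iff[OF k(1), of v] depth_less[of v] k(2) by auto
    then have "children T (e (k - 1)) \<inter> internals T = {}"
      by blast
    ultimately show ?thesis
      using card_leaf_children[OF e(1)[OF k(1)]] by simp
  qed
  moreover have "\<forall>v\<in>tverts T. outdegree T v = 0 \<or> outdegree T v = 2"
  proof
    show "outdegree T v = 0 \<or> outdegree T v = 2" if "v \<in> tverts T" for v
      using deg[of v] that by (cases "v \<in> internals T") (auto simp: internals_def leaves_def)
  qed
  ultimately show "binary_caterpillar n T"
    unfolding binary_caterpillar_def using T r
    by (intro conjI exI[of _ ?vs] allI impI) blast+
qed

lemma separates_internal: "rooted_tree T \<Longrightarrow> separates T u a b \<Longrightarrow> u \<in> internals T"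
  by (auto simp: separates_def internals_iff)

lemma leaf_induced_iso:
  assumes T: "topological_tree T"
    and shape: "card (internals T) = 1 \<or>
      (\<forall>v\<in>internals T. outdegree T v = 2) \<and> internals_chain T"
    and A: "A \<in> leaf_induced_subtrees T" and B: "B \<in> leaf_induced_subtrees T"
    and leaves: "card (leaves A) = card (leaves B)"
  shows "rtree_iso A B"
proof -
  note R = topological_treeD[OF T]
  \<comment> \<open>The common outdegree is chosen as a function of the leaf count of
    \<open>C\<close>, so that it agrees for \<open>A\<close> and \<open>B\<close> in both
    cases.\<close>
  have chain_deg: "internals_chain C \<and> (\<forall>v\<in>internals C. outdegree C v =
      (if card (internals T) = 1 then card (leaves C) else 2))"
    and topo: "topological_tree C" if C: "C \<in> leaf_induced_subtrees T" for C
  proof -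
    obtain S where "S \<noteq> {}" "S \<subseteq> leaves T" "leaf_induced_subtree T S C"
      using C by (auto simp: leaf_induced_subtrees_def)
    note p = leaf_induced_props[OF R this]
    show "topological_tree C"
      by (rule p(1))
    note RC = topological_treeD[OF p(1)]
    have sub: "internals C \<subseteq> internals T"
      unfolding p(3) using separates_internal[OF R] by blast
    show "internals_chain C \<and> (\<forall>v\<in>internals C. outdegree C v =
      (if card (internals T) = 1 then card (leaves C) else 2))"
    proof (cases "card (internals T) = 1")
      case True
      then obtain r where r: "internals T = {r}"
        by (auto simp: card_1_singleton_iff)
      have "outdegree C v = card (leaves C)" if "v \<in> internals C" for v
      proof -
        have "internals C = {v}"
          using sub that unfolding r by blast
        then show ?thesis
          using card_verts[OF RC] card_verts_eq_sum_outdegree[OF RC] by simp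
      qed
      moreover have "comparable C u v" if "u \<in> internals C" "v \<in> internals C" for u v
      proof -
        have "u = v"
          using that sub unfolding r by blast
        then show ?thesis
          by (simp add: comparable_def)
      qed
      ultimately show ?thesis
        using True by (simp add: internals_chain_def)
    next
      case False
      then have ch: "internals_chain T" and deg: "\<And>v. v \<in> internals T \<Longrightarrow> outdegree T v = 2"
        using shape by auto
      have "outdegree C v = 2" if v: "v \<in> internals C" for v
      proof -
        have "v \<in> tverts C" "v \<in> internals T"
          using v sub internals_subset[of C] by blast+
        then show ?thesis
          \<comment> \<open>The outdegree is squeezed: at least 2 because \<open>C\<close> is
            topological, at most 2 because it cannot exceed that in \<open>T\<close>.\<close>
          using outdegree_ge_2[OF p(1) v] p(4)[of v] deg[of v] by simp
      qed
      moreover have "comparable C u v" if uv: "u \<in> internals C" "v \<in> internals C" for u v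
      proof -
        have "comparable T u v"
          using ch sub uv by (auto simp: internals_chain_def)
        then show ?thesis
          using p(6) internals_subset[of C] uv by (auto simp: comparable_def)
      qed
      ultimately show ?thesis
        using False by (simp add: internals_chain_def)
    qed
  qed
  show ?thesis
    using chain_deg[OF A] chain_deg[OF B] leaves
    by (intro uniform_chain_iso[OF topo[OF A] _ _ topo[OF B]]) auto
qed

section \<open>Counting isomorphism classes\<close>

lemma card_quotient_invariant:
  assumes "finite X" and r: "equiv X r" and inv: "\<And>a b. (a, b) \<in> r \<Longrightarrow> g a = g b"
  shows "card (g ` X) \<le> card (X // r)"
    and "card (X // r) = card (g ` X) \<longleftrightarrow> (\<forall>a\<in>X. \<forall>b\<in>X. g a = g b \<longrightarrow> (a, b) \<in> r)"
proof -
  let ?G = "\<lambda>C. g (SOME a. a \<in> C)"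
  have G: "?G (r `` {a}) = g a" if "a \<in> X" for a
  proof -
    have "a \<in> r `` {a}"
      using r that by (rule equiv_class_self)
    then have "(SOME b. b \<in> r `` {a}) \<in> r `` {a}"
      by (rule someI)
    then show ?thesis
      using inv by fastforce
  qed
  have im: "?G ` (X // r) = g ` X"
  proof -
    have "?G ` (X // r) = (\<lambda>a. ?G (r `` {a})) ` X"
      unfolding quotient_def by blast
    also have "\<dots> = g ` X"
      using G by (rule image_cong[OF refl])
    finally show ?thesis .
  qed
  have fin: "finite (X // r)"
    using assms(1) by (simp add: quotient_def)
  show "card (g ` X) \<le> card (X // r)"
    using card_image_le[OF fin, of ?G] im by simp
  have "card (X // r) = card (g ` X) \<longleftrightarrow> inj_on ?G (X // r)"
    using inj_on_iff_eq_card[OF fin, of ?G] im by auto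
  also have "\<dots> \<longleftrightarrow> (\<forall>a\<in>X. \<forall>b\<in>X. ?G (r `` {a}) = ?G (r `` {b}) \<longrightarrow> r `` {a} = r `` {b})"
    by (auto simp: inj_on_def quotient_def)
  also have "\<dots> \<longleftrightarrow> (\<forall>a\<in>X. \<forall>b\<in>X. g a = g b \<longrightarrow> (a, b) \<in> r)"
    using G eq_equiv_class_iff[OF r] by simp
  finally show "card (X // r) = card (g ` X) \<longleftrightarrow> (\<forall>a\<in>X. \<forall>b\<in>X. g a = g b \<longrightarrow> (a, b) \<in> r)" .
qed

lemma leaf_induced_topological:
  assumes "rooted_tree T" "A \<in> leaf_induced_subtrees T"
  shows "topological_tree A"
  using assms leaf_induced_props(1) by (auto simp: leaf_induced_subtrees_def)

lemma card_leaves_image: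
  assumes T: "rooted_tree T"
  shows "(\<lambda>B. card (leaves B)) ` leaf_induced_subtrees T = {1..card (leaves T)}"
proof (intro equalityI subsetI)
  fix m assume "m \<in> (\<lambda>B. card (leaves B)) ` leaf_induced_subtrees T"
  then obtain S B where S: "S \<noteq> {}" "S \<subseteq> leaves T" "leaf_induced_subtree T S B"
    and m: "m = card (leaves B)"
    by (auto simp: leaf_induced_subtrees_def)
  have "m = card S"
    using m leaf_induced_props(2)[OF T S] by simp
  then show "m \<in> {1..card (leaves T)}"
    using S finite_leaves[OF T] by (simp add: card_mono Suc_le_eq card_gt_0_iff finite_subset)
next
  fix m assume m: "m \<in> {1..card (leaves T)}"
  then obtain S where S: "S \<subseteq> leaves T" "card S = m"
    using obtain_subset_with_card_n[of m "leaves T"] by auto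
  moreover have "S \<noteq> {}"
    using S m by auto
  moreover obtain B where B: "leaf_induced_subtree T S B"
    using ex_leaf_induced_subtree[OF T] calculation by blast
  ultimately have "B \<in> leaf_induced_subtrees T" "card (leaves B) = m"
    using leaf_induced_props(2)[OF T _ _ B] by (auto simp: leaf_induced_subtrees_def)
  then show "m \<in> (\<lambda>B. card (leaves B)) ` leaf_induced_subtrees T"
    by blast
qed

text \<open>The number of leaves is an isomorphism invariant that takes each value from 1 to
  \<open>card (leaves T)\<close>; the claim is \<open>card_quotient_invariant\<close> for
  it.\<close>

lemma num_leaf_induced_subtrees_bound:
  assumes T: "rooted_tree T"
  shows "card (leaves T) \<le> num_leaf_induced_subtrees T"
    and "num_leaf_induced_subtrees T = card (leaves T) \<longleftrightarrow>
      (\<forall>A\<in>leaf_induced_subtrees T. \<forall>B\<in>leaf_induced_subtrees T.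
        card (leaves A) = card (leaves B) \<longrightarrow> rtree_iso A B)"
proof -
  let ?X = "leaf_induced_subtrees T"
  let ?r = "{(A, B). A \<in> ?X \<and> B \<in> ?X \<and> rtree_iso A B}"
  have R: "rooted_tree A" if "A \<in> ?X" for A
    using leaf_induced_topological[OF T that] by (rule topological_treeD)
  have "equiv ?X ?r"
  proof (rule equivI)
    show "?r \<subseteq> ?X \<times> ?X"
      by auto
    show "refl_on ?X ?r"
      by (auto simp: refl_on_def rtree_iso_refl)
    show "sym ?r"
      using R by (auto simp: sym_def intro: rtree_iso_sym)
    show "trans ?r"
      by (auto simp: trans_def intro: rtree_iso_trans)
  qed
  moreover have "card (leaves A) = card (leaves B)" if "(A, B) \<in> ?r" for A B
    using that R rtree_iso_invariants(2) by blast
  ultimately have *: "card ((\<lambda>B. card (leaves B)) ` ?X) \<le> card (?X // ?r)"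
    "card (?X // ?r) = card ((\<lambda>B. card (leaves B)) ` ?X) \<longleftrightarrow>
      (\<forall>A\<in>?X. \<forall>B\<in>?X. card (leaves A) = card (leaves B) \<longrightarrow> (A, B) \<in> ?r)"
    using card_quotient_invariant[OF finite_leaf_induced_subtrees[OF T], where g = "\<lambda>B. card (leaves B)"]
    by blast+
  show "card (leaves T) \<le> num_leaf_induced_subtrees T"
    using *(1) by (simp add: card_leaves_image[OF T] num_leaf_induced_subtrees_def)
  show "num_leaf_induced_subtrees T = card (leaves T) \<longleftrightarrow>
      (\<forall>A\<in>?X. \<forall>B\<in>?X. card (leaves A) = card (leaves B) \<longrightarrow> rtree_iso A B)"
    using *(2) by (simp add: card_leaves_image[OF T] num_leaf_induced_subtrees_def)
qed

section \<open>Trees that attain the bound\<close>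

text \<open>The internal vertices of the subtree induced by \<open>S\<close>.\<close>

definition branchings :: "'a rtree \<Rightarrow> 'a set \<Rightarrow> 'a set" where
  "branchings T S = {u. \<exists>a\<in>S. \<exists>b\<in>S. separates T u a b}"

text \<open>Translates the isomorphism of equally large induced subtrees into statements about
  common ancestors in \<open>T\<close>, so that the extremal argument can work with leaf sets
  only.\<close>

lemma branchings_invariants:
  assumes T: "topological_tree T"
    and iso: "\<forall>A\<in>leaf_induced_subtrees T. \<forall>B\<in>leaf_induced_subtrees T.
      card (leaves A) = card (leaves B) \<longrightarrow> rtree_iso A B"
    and S: "S \<noteq> {}" "S \<subseteq> leaves T" and S': "S' \<subseteq> leaves T" and card: "card S = card S'"
  shows "card (branchings T S) = card (branchings T S')"
    and "\<forall>u\<in>branchings T S. \<forall>v\<in>branchings T S. comparable T u v \<Longrightarrow>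
      u \<in> branchings T S' \<Longrightarrow> v \<in> branchings T S' \<Longrightarrow> comparable T u v"
proof -
  note R = topological_treeD[OF T]
  have "card S \<noteq> 0"
    using S finite_leaves[OF R] by (auto dest: finite_subset)
  then have "S' \<noteq> {}"
    using card by auto
  note S' = this S'
  obtain A where A: "leaf_induced_subtree T S A"
    using ex_leaf_induced_subtree[OF R S] by blast
  obtain B where B: "leaf_induced_subtree T S' B"
    using ex_leaf_induced_subtree[OF R S'] by blast
  note pA = leaf_induced_props[OF R S A, folded branchings_def]
    and pB = leaf_induced_props[OF R S' B, folded branchings_def]
  have "A \<in> leaf_induced_subtrees T" "B \<in> leaf_induced_subtrees T"
    using A B S S' unfolding leaf_induced_subtrees_def by blast+
  then have "rtree_iso A B"
    using iso card pA(2) pB(2) by simp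
  note inv = rtree_iso_invariants[OF topological_treeD[OF pA(1)] topological_treeD[OF pB(1)] this]
  show "card (branchings T S) = card (branchings T S')"
    using inv(1) pA(3) pB(3) by simp
  show "comparable T u v" if all: "\<forall>u\<in>branchings T S. \<forall>v\<in>branchings T S. comparable T u v"
    and uv: "u \<in> branchings T S'" "v \<in> branchings T S'"
  proof -
    have "comparable A x y" if xy: "x \<in> internals A" "y \<in> internals A" for x y
    proof -
      have "comparable T x y"
        using all xy pA(3) by simp
      then show ?thesis
        using xy internals_subset[of A] pA(6) by (auto simp: comparable_def)
    qed
    then have "internals_chain B"
      using inv(3) by (simp add: internals_chain_def)
    then have "comparable B u v"
      using uv pB(3) by (simp add: internals_chain_def)
    then show ?thesis
      using uv pB(3,6) internals_subset[of B] by (auto simp: comparable_def)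
  qed
qed

text \<open>Any two of the pairs formed by the three elements of \<open>X\<close> share an element, so their common
  ancestors are comparable; the common ancestors involving \<open>e\<close> all lie above \<open>w\<close>.\<close>

lemma branchings_comparable:
  assumes T: "rooted_tree T" and X: "card X = 3"
    and w: "\<And>x. x \<in> X \<Longrightarrow> (w, x) \<in> (tarcs T)\<^sup>*" and e: "(w, e) \<notin> (tarcs T)\<^sup>*"
    and uv: "u \<in> branchings T (insert e X)" "v \<in> branchings T (insert e X)"
  shows "comparable T u v"
proof -
  have below: "(w, u) \<in> (tarcs T)\<^sup>*" if "a \<in> X" "b \<in> X" "separates T u a b" for u a b
    using separates_below[OF T that(3)] w that by blast
  have above: "(u, w) \<in> (tarcs T)\<^sup>*" if "a \<in> X" "separates T u a e" for u a
  proof -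
    have "(w, u) \<notin> (tarcs T)\<^sup>*"
      using e separates_reach(2)[OF that(2)] by (meson rtrancl_trans)
    then show ?thesis
      using ancestors_comparable[OF T separates_reach(1)[OF that(2)] w[OF that(1)]]
      by (auto simp: comparable_def)
  qed
  have split: "(\<exists>a\<in>X. \<exists>b\<in>X. separates T u a b) \<or> (u, w) \<in> (tarcs T)\<^sup>*"
    if u: "u \<in> branchings T (insert e X)" for u
  proof -
    obtain a b where ab: "a \<in> insert e X" "b \<in> insert e X" "separates T u a b"
      using u unfolding branchings_def by blast
    then have "a \<noteq> b"
      using separates_neq[OF T] by blast
    then consider "a \<in> X" "b \<in> X" | "a \<in> X" "b = e" | "a = e" "b \<in> X"
      using ab by blast
    then show ?thesis
      using ab(3) above[of a u] above[of b u] separates_sym[OF ab(3)] by cases blast+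
  qed
  consider a b c d where "a \<in> X" "b \<in> X" "separates T u a b" "c \<in> X" "d \<in> X" "separates T v c d"
    | a b where "a \<in> X" "b \<in> X" "separates T u a b" "(v, w) \<in> (tarcs T)\<^sup>*"
    | c d where "(u, w) \<in> (tarcs T)\<^sup>*" "c \<in> X" "d \<in> X" "separates T v c d"
    | "(u, w) \<in> (tarcs T)\<^sup>*" "(v, w) \<in> (tarcs T)\<^sup>*"
    using split[OF uv(1)] split[OF uv(2)] by blast
  then show ?thesis
  proof cases
    case 1
    have "a \<noteq> b" "c \<noteq> d"
      using 1 separates_neq[OF T] by blast+
    \<comment> \<open>Two pairs inside a set of three elements must meet, and a shared leaf has both
      \<open>u\<close> and \<open>v\<close> as ancestors.\<close>
    moreover have "card {a, b, c, d} \<le> 3"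
      using 1 X by (metis card_mono card.infinite empty_subsetI insert_subset zero_neq_numeral)
    ultimately have "a = c \<or> a = d \<or> b = c \<or> b = d"
      by (auto simp: card_insert_if split: if_splits)
    then obtain x where "(u, x) \<in> (tarcs T)\<^sup>*" "(v, x) \<in> (tarcs T)\<^sup>*"
      using separates_reach[OF 1(3)] separates_reach[OF 1(6)] by blast
    then show ?thesis
      by (rule ancestors_comparable[OF T])
  next
    case 2
    then show ?thesis
      using below[of a b u] unfolding comparable_def by (meson rtrancl_trans)
  next
    case 3
    then show ?thesis
      using below[of c d v] unfolding comparable_def by (meson rtrancl_trans)
  next
    case 4
    then show ?thesis
      by (rule ancestors_comparable[OF T])
  qed
qed

lemma star_or_caterpillar:
  assumes T: "topological_tree T" and n: "card (leaves T) \<ge> 5"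
    and iso: "\<forall>A\<in>leaf_induced_subtrees T. \<forall>B\<in>leaf_induced_subtrees T.
      card (leaves A) = card (leaves B) \<longrightarrow> rtree_iso A B"
  shows "card (internals T) = 1 \<or> (\<forall>v\<in>internals T. outdegree T v = 2) \<and> internals_chain T"
  unfolding disj_imp
proof
  note R = topological_treeD[OF T]
  note inv = branchings_invariants[OF T iso]
  assume "card (internals T) \<noteq> 1"
  have root: "troot T \<in> internals T"
    using root_internal[OF R] n by simp
  have "internals T \<noteq> {troot T}"
    using \<open>card (internals T) \<noteq> 1\<close> by auto
  then obtain u where u: "u \<in> internals T" "u \<noteq> troot T"
    using root by blast
  obtain a b where ab: "a \<in> leaves T" "b \<in> leaves T" "separates T u a b"
    using internal_separates[OF T u(1)] by blast
  obtain p where p: "(p, u) \<in> tarcs T"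
    using rooted_tree_ex_parent[OF R] u internals_subset[of T] by blast
  obtain y where y: "(p, y) \<in> tarcs T" "y \<noteq> u"
    using ex_other_child[OF T p] by blast
  obtain c where c: "c \<in> leaves T" "(y, c) \<in> (tarcs T)\<^sup>*"
    using ex_leaf_below[OF R arc_verts(2)[OF R y(1)]] by blast
  have pac: "separates T p a c" "separates T p b c"
    using p y c(2) separates_reach[OF ab(3)] unfolding separates_def by metis+
  have fin: "finite (branchings T S)" for S
    using separates_internal[OF R] by (intro finite_subset[OF _ finite_internals[OF R]])
      (auto simp: branchings_def)
  \<comment> \<open>\<open>u\<close> separates \<open>a\<close> from \<open>b\<close>, and its
    parent \<open>p\<close> separates both from \<open>c\<close>: these three leaves induce a tree
    that is not a star.\<close>
  have "{u, p} \<subseteq> branchings T {a, b, c}"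
    using ab(3) pac unfolding branchings_def by blast
  moreover have "u \<noteq> p"
    using arc_not_reach_back[OF R p] by blast
  ultimately have ge2: "card (branchings T {a, b, c}) \<ge> 2"
    using card_mono[OF fin, of "{u, p}"] by (metis card_2_iff)
  have abc: "card {a, b, c} = 3"
    using separates_neq[OF R] ab(3) pac by simp
  have deg: "outdegree T v = 2" if v: "v \<in> internals T" for v
  proof (rule ccontr)
    assume "outdegree T v \<noteq> 2"
    then have "3 \<le> card (children T v)"
      using outdegree_ge_2[OF T v] by (simp add: outdegree_def)
    then obtain X where "X \<subseteq> children T v" "card X = 3"
      using obtain_subset_with_card_n by metis
    then obtain x1 x2 x3 where x: "x1 \<in> children T v" "x2 \<in> children T v" "x3 \<in> children T v"
      "x1 \<noteq> x2" "x1 \<noteq> x3" "x2 \<noteq> x3"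
      by (auto simp: card_3_iff)
    have leaf: "\<exists>s\<in>leaves T. (x, s) \<in> (tarcs T)\<^sup>*" if "x \<in> children T v" for x
      using that ex_leaf_below[OF R] arc_verts(2)[OF R, of v x] by (simp add: children_def)
    obtain a1 a2 a3 where a: "a1 \<in> leaves T" "a2 \<in> leaves T" "a3 \<in> leaves T"
      "(x1, a1) \<in> (tarcs T)\<^sup>*" "(x2, a2) \<in> (tarcs T)\<^sup>*" "(x3, a3) \<in> (tarcs T)\<^sup>*"
      using leaf x(1-3) by metis
    have sep: "separates T v a1 a2" "separates T v a1 a3" "separates T v a2 a3"
      using x a unfolding separates_def children_def by blast+
    then have "card {a1, a2, a3} = 3"
      using separates_neq[OF R] by simp
    then have "card {a, b, c} = card {a1, a2, a3}"
      using abc by simp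
    then have "card (branchings T {a1, a2, a3}) \<ge> 2"
      using inv(1)[of "{a, b, c}" "{a1, a2, a3}"] ge2 ab(1,2) c(1) a(1-3) by simp
    \<comment> \<open>Leaves below three different children of \<open>v\<close> are pairwise
      separated by \<open>v\<close>, so they induce a star, contrary to the count for
      \<open>{a, b, c}\<close>.\<close>
    moreover have "branchings T {a1, a2, a3} \<subseteq> {v}"
    proof
      fix w assume "w \<in> branchings T {a1, a2, a3}"
      then obtain s t where st: "s \<in> {a1, a2, a3}" "t \<in> {a1, a2, a3}" "separates T w s t"
        unfolding branchings_def by blast
      have "s \<noteq> t"
        using separates_neq[OF R st(3)] .
      then have "separates T v s t"
        using st(1,2) sep sep[THEN separates_sym] by auto
      then show "w \<in> {v}"
        using separates_unique[OF R st(3)] by simp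
    qed
    ultimately show False
      using card_mono[of "{v}" "branchings T {a1, a2, a3}"] by simp
  qed
  moreover have "internals_chain T"
    unfolding internals_chain_def
  proof (intro ballI)
    fix s t assume st: "s \<in> internals T" "t \<in> internals T"
    obtain x y where xy: "children T (troot T) = {x, y}" "x \<noteq> y"
      using deg[OF root] by (auto simp: outdegree_def card_2_iff)
    then have arcs: "(troot T, x) \<in> tarcs T" "(troot T, y) \<in> tarcs T"
      by (auto simp: children_def)
    let ?L = "\<lambda>z. {l \<in> leaves T. (z, l) \<in> (tarcs T)\<^sup>*}"
    have "leaves T \<subseteq> ?L x \<union> ?L y"
    proof
      fix l assume l: "l \<in> leaves T"
      then have "(troot T, l) \<in> (tarcs T)\<^sup>*" "l \<noteq> troot T"
        using rooted_tree_root_reach[OF R] root leaves_Un_internals[of T] by blast+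
      then obtain z where z: "(troot T, z) \<in> tarcs T" "(z, l) \<in> (tarcs T)\<^sup>*"
        by (metis converse_rtranclE)
      then have "z \<in> {x, y}"
        unfolding xy(1)[symmetric] by (simp add: children_def)
      then show "l \<in> ?L x \<union> ?L y"
        using z(2) l by blast
    qed
    then have "card (leaves T) \<le> card (?L x \<union> ?L y)"
      using finite_leaves[OF R] by (intro card_mono) auto
    then have "5 \<le> card (?L x) + card (?L y)"
      using n card_Un_le[of "?L x" "?L y"] by linarith
    then have "3 \<le> card (?L x) \<or> 3 \<le> card (?L y)"
      by linarith
    then obtain z z' where z: "3 \<le> card (?L z)" "(troot T, z) \<in> tarcs T"
      and z': "(troot T, z') \<in> tarcs T" "z \<noteq> z'"
      using arcs xy(2) by blast
    obtain X where X: "X \<subseteq> ?L z" "card X = 3"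
      using obtain_subset_with_card_n[OF z(1)] by metis
    obtain e where e: "e \<in> leaves T" "(z', e) \<in> (tarcs T)\<^sup>*"
      using ex_leaf_below[OF R arc_verts(2)[OF R z'(1)]] by blast
    \<comment> \<open>With \<open>z\<close> as the vertex above \<open>X\<close> but not above
      \<open>e\<close>, this is what \<open>branchings_comparable\<close> needs in order to make the
      four leaves induce a chain.\<close>
    have not_below: "(z, e) \<notin> (tarcs T)\<^sup>*"
      using child_unique[OF R z(2) z'(1) _ e(2)] z'(2) by blast
    then have "e \<notin> X"
      using X(1) by blast
    then have card4: "card (insert e X) = 4"
      using X(2) card_ge_0_finite[of X] by simp
    have chain: "\<forall>u\<in>branchings T (insert e X). \<forall>v\<in>branchings T (insert e X). comparable T u v"
      using X branchings_comparable[OF R X(2) _ not_below] by blast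
    show "comparable T s t"
    proof (rule ccontr)
      assume not: "\<not> comparable T s t"
      obtain a b where ab: "a \<in> leaves T" "b \<in> leaves T" "separates T s a b"
        using internal_separates[OF T st(1)] by blast
      obtain c d where cd: "c \<in> leaves T" "d \<in> leaves T" "separates T t c d"
        using internal_separates[OF T st(2)] by blast
      \<comment> \<open>A shared leaf would have both \<open>s\<close> and \<open>t\<close> as
        ancestors and make them comparable. The four leaves are therefore distinct, and the chain
        property carries over to them from \<open>insert e X\<close>.\<close>
      have "{c, d} \<inter> {a, b} = {}"
        using not ancestors_comparable[OF R] separates_reach[OF ab(3)] separates_reach[OF cd(3)]
        by blast
      then have "card (insert e X) = card {a, b, c, d}"
        using card4 separates_neq[OF R ab(3)] separates_neq[OF R cd(3)] by simp
      moreover have "insert e X \<subseteq> leaves T" "{a, b, c, d} \<subseteq> leaves T"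
        using X(1) e(1) ab cd by auto
      moreover have "s \<in> branchings T {a, b, c, d}" "t \<in> branchings T {a, b, c, d}"
        using ab(3) cd(3) unfolding branchings_def by blast+
      ultimately show False
        using inv(2)[OF _ _ _ _ chain] not by blast
    qed
  qed
  ultimately show "(\<forall>v\<in>internals T. outdegree T v = 2) \<and> internals_chain T"
    by blast
qed

theorem theorem2p1:
  fixes n :: nat and T :: "'a rtree"
  assumes "n \<ge> 5"
    and "topological_tree T"
    and "card (leaves T) = n"
  shows "num_leaf_induced_subtrees T \<ge> n \<and>
    (num_leaf_induced_subtrees T = n \<longleftrightarrow> star_tree n T \<or> binary_caterpillar n T)"
proof -
  note R = topological_treeD[OF assms(2)]
  \<comment> \<open>Both families are rephrased through internal vertices, the form in which the two
    directions are available.\<close>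
  have shape: "star_tree n T \<or> binary_caterpillar n T \<longleftrightarrow>
      card (internals T) = 1 \<or> (\<forall>v\<in>internals T. outdegree T v = 2) \<and> internals_chain T"
    using star_tree_iff[OF R assms(3)] binary_caterpillar_iff[OF R] assms by simp
  have "num_leaf_induced_subtrees T = n \<longleftrightarrow> star_tree n T \<or> binary_caterpillar n T"
    unfolding shape
  proof
    assume "num_leaf_induced_subtrees T = n"
    then have "num_leaf_induced_subtrees T = card (leaves T)" "card (leaves T) \<ge> 5"
      using assms(1,3) by auto
    then show "card (internals T) = 1 \<or>
        (\<forall>v\<in>internals T. outdegree T v = 2) \<and> internals_chain T"
      using star_or_caterpillar[OF assms(2)] num_leaf_induced_subtrees_bound(2)[OF R] by blast
  next
    assume "card (internals T) = 1 \<or> (\<forall>v\<in>internals T. outdegree T v = 2) \<and> internals_chain T"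
    then show "num_leaf_induced_subtrees T = n"
      using leaf_induced_iso[OF assms(2)] num_leaf_induced_subtrees_bound(2)[OF R] assms(3)
      by simp
  qed
  then show ?thesis
    using num_leaf_induced_subtrees_bound(1)[OF R] assms(3) by simp
qed

end
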